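(* An arithmetic divisor on $\overline{\operatorname{Spec}\mathbf{Z}}$ is a pair $(L,\|\cdot\|)$ with $L$ a torsion-free abelian group of rank $1$ and $\|\cdot\|$ a semi-norm on $L_\mathbf{R}=L\otimes_\mathbf{Z}\mathbf{R}$ of the form $\|v\|=\lambda|\phi(v)|$ for some isomorphism $\phi:L_\mathbf{R}\to\mathbf{R}$ and some $\lambda\ge0$. Two such, $(L_1,\|\cdot\|_1)$ and $(L_2,\|\cdot\|_2)$, are isomorphic if there is a group isomorphism $\psi:L_1\to L_2$ with $\|\psi(x)\|_2=\|x\|_1$ for all $x$ (extending $\psi$ to $L_{1,\mathbf{R}}$). The product is $(L_1,\|\cdot\|_1)\cdot(L_2,\|\cdot\|_2)=(L_1\otimes_\mathbf{Z}L_2,\|\cdot\|)$ with $\|v_1\otimes v_2\|=\|v_1\|_1\|v_2\|_2$. Let $\operatorname{Pic}(\overline{\operatorname{Spec}\mathbf{Z}})$ be the monoid of isomorphism classes with this product. Let $\mathbb{A}=\mathbb{A}_f\times\mathbf{R}$ be the adeles of $\mathbf{Q}$, $\widehat{\mathbf{Z}}\subset\mathbb{A}_f$ the profinite integers, and $X_\mathbf{Q}=\mathbf{Q}^\times\backslash\mathbb{A}/\widehat{\mathbf{Z}}^\times$ with the monoid structure induced by multiplication of adeles. For $a=(a_f,a_\infty)\in\mathbb{A}$ let $\Lambda(a)=(L_a,\|\cdot\|_a)$, where $L_a=\{q\in\mathbf{Q}\mid a_fq\in\widehat{\mathbf{Z}}\}$ and $\|v\|_a=|a_\infty|\,|v|$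 via the canonical identification $L_a\otimes\mathbf{R}\cong\mathbf{Q}\otimes\mathbf{R}\cong\mathbf{R}$. Then $\Lambda$ induces a canonical monoid isomorphism $X_\mathbf{Q}\cong\operatorname{Pic}(\overline{\operatorname{Spec}\mathbf{Z}})$. *)

theory Defs
  imports "HOL-Algebra.Algebra" "HOL-Algebra.Free_Abelian_Groups" Complex_Main
begin

text \<open>Profinite integers: compatible systems of residues x n in {0..<n} modulo every n > 0
  (the inverse limit of Z/nZ); the value at 0 is normalised to 0.\<close>
definition zhat :: "(nat \<Rightarrow> int) set" where
  "zhat = {x. x 0 = 0 \<and> (\<forall>n>0. 0 \<le> x n \<and> x n < int n) \<and>
               (\<forall>m n. 0 < m \<and> 0 < n \<and> m dvd n \<longrightarrow> x m = x n mod int m)}"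

definition zadd :: "(nat \<Rightarrow> int) \<Rightarrow> (nat \<Rightarrow> int) \<Rightarrow> (nat \<Rightarrow> int)" where
  "zadd x y = (\<lambda>n. if n = 0 then 0 else (x n + y n) mod int n)"

definition zmul :: "(nat \<Rightarrow> int) \<Rightarrow> (nat \<Rightarrow> int) \<Rightarrow> (nat \<Rightarrow> int)" where
  "zmul x y = (\<lambda>n. if n = 0 then 0 else (x n * y n) mod int n)"

definition zint :: "int \<Rightarrow> (nat \<Rightarrow> int)" where
  "zint k = (\<lambda>n. if n = 0 then 0 else k mod int n)"

definition zunits :: "(nat \<Rightarrow> int) set" where
  "zunits = {u \<in> zhat. \<exists>v \<in> zhat. zmul u v = zint 1}"

text \<open>Finite adeles A_f = Zhat \<otimes> Q, represented by pairs (z, d) with z \<in> Zhat, d > 0,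
  standing for z/d.  An adele is a pair (finite part, real part).\<close>
type_synonym afin = "(nat \<Rightarrow> int) \<times> nat"
type_synonym adele = "afin \<times> real"

definition adeles :: "adele set" where
  "adeles = {((z, d), r). z \<in> zhat \<and> d > 0}"

definition afin_eq :: "afin \<Rightarrow> afin \<Rightarrow> bool" where
  "afin_eq a b = (zmul (zint (int (snd b))) (fst a) = zmul (zint (int (snd a))) (fst b))"

definition adele_eq :: "adele \<Rightarrow> adele \<Rightarrow> bool" where
  "adele_eq a b = (afin_eq (fst a) (fst b) \<and> snd a = snd b)"

definition afin_mult :: "afin \<Rightarrow> afin \<Rightarrow> afin" where
  "afin_mult a b = (zmul (fst a) (fst b), snd a * snd b)"

definition adele_mult :: "adele \<Rightarrow> adele \<Rightarrow> adele" where
  "adele_mult a b = (afin_mult (fst a) (fst b), snd a * snd b)"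

definition afin_scale :: "rat \<Rightarrow> afin \<Rightarrow> afin" where
  "afin_scale q a = (case quotient_of q of (m, k) \<Rightarrow> (zmul (zint m) (fst a), nat k * snd a))"

definition adele_scale :: "rat \<Rightarrow> adele \<Rightarrow> adele" where
  "adele_scale q a = (afin_scale q (fst a), real_of_rat q * snd a)"

definition adele_unit :: "(nat \<Rightarrow> int) \<Rightarrow> adele \<Rightarrow> adele" where
  "adele_unit u a = ((zmul u (fst (fst a)), snd (fst a)), snd a)"

definition afin_integral :: "afin \<Rightarrow> bool" where
  "afin_integral a = (\<exists>w \<in> zhat. fst a = zmul (zint (int (snd a))) w)"

definition XQ_rel :: "adele \<Rightarrow> adele \<Rightarrow> bool" where
  "XQ_rel a b = (\<exists>q::rat. q \<noteq> 0 \<and> (\<exists>u \<in> zunits. adele_eq b (adele_unit u (adele_scale q a))))"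

definition real_add_group :: "real monoid" where
  "real_add_group = \<lparr>carrier = UNIV, monoid.mult = (+), one = 0\<rparr>"

definition torsion_free_rank1 :: "'a monoid \<Rightarrow> bool" where
  "torsion_free_rank1 L =
     (comm_group L \<and>
      (\<forall>x \<in> carrier L. \<forall>n::int. n \<noteq> 0 \<and> x [^]\<^bsub>L\<^esub> n = \<one>\<^bsub>L\<^esub> \<longrightarrow> x = \<one>\<^bsub>L\<^esub>) \<and>
      (\<exists>x \<in> carrier L. x \<noteq> \<one>\<^bsub>L\<^esub>) \<and>
      (\<forall>x \<in> carrier L. \<forall>y \<in> carrier L. \<exists>(m::int) (n::int). (m \<noteq> 0 \<or> n \<noteq> 0) \<and>
           x [^]\<^bsub>L\<^esub> m \<otimes>\<^bsub>L\<^esub> y [^]\<^bsub>L\<^esub> n = \<one>\<^bsub>L\<^esub>))"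

text \<open>An arithmetic divisor (L, N): N is the semi-norm \<lambda>|\<phi>(-)| restricted to L \<subseteq> L \<otimes> R.
  Restricting an isomorphism \<phi> : L_R \<rightarrow> R to L gives exactly an injective homomorphism
  L \<rightarrow> (R,+) (and every such extends uniquely to an isomorphism L_R \<rightarrow> R), and the
  semi-norm on L_R is determined by its values on L.\<close>
definition arith_divisor :: "'a monoid \<times> ('a \<Rightarrow> real) \<Rightarrow> bool" where
  "arith_divisor D =
     (torsion_free_rank1 (fst D) \<and>
      (\<exists>f lam. f \<in> hom (fst D) real_add_group \<and> inj_on f (carrier (fst D)) \<and> lam \<ge> 0 \<and>
               (\<forall>x \<in> carrier (fst D). snd D x = lam * \<bar>f x\<bar>)))"

definition div_iso :: "'a monoid \<times> ('a \<Rightarrow> real) \<Rightarrow> 'b monoid \<times> ('b \<Rightarrow> real) \<Rightarrow> bool" where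
  "div_iso D1 D2 =
     (\<exists>\<psi>. \<psi> \<in> iso (fst D1) (fst D2) \<and> (\<forall>x \<in> carrier (fst D1). snd D2 (\<psi> x) = snd D1 x))"

definition tensor_rels :: "'a monoid \<Rightarrow> 'b monoid \<Rightarrow> (('a \<times> 'b) \<Rightarrow>\<^sub>0 int) set" where
  "tensor_rels L1 L2 =
     {Poly_Mapping.single (x \<otimes>\<^bsub>L1\<^esub> x', y) 1 - Poly_Mapping.single (x, y) 1 - Poly_Mapping.single (x', y) 1
        | x x' y. x \<in> carrier L1 \<and> x' \<in> carrier L1 \<and> y \<in> carrier L2} \<union>
     {Poly_Mapping.single (x, y \<otimes>\<^bsub>L2\<^esub> y') 1 - Poly_Mapping.single (x, y) 1 - Poly_Mapping.single (x, y') 1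
        | x y y'. x \<in> carrier L1 \<and> y \<in> carrier L2 \<and> y' \<in> carrier L2}"

definition tensor_group :: "'a monoid \<Rightarrow> 'b monoid \<Rightarrow> (('a \<times> 'b) \<Rightarrow>\<^sub>0 int) set monoid" where
  "tensor_group L1 L2 =
     free_Abelian_group (carrier L1 \<times> carrier L2) Mod
       generate (free_Abelian_group (carrier L1 \<times> carrier L2)) (tensor_rels L1 L2)"

definition tensor_elem :: "'a monoid \<Rightarrow> 'b monoid \<Rightarrow> 'a \<Rightarrow> 'b \<Rightarrow> (('a \<times> 'b) \<Rightarrow>\<^sub>0 int) set" where
  "tensor_elem L1 L2 x y =
     generate (free_Abelian_group (carrier L1 \<times> carrier L2)) (tensor_rels L1 L2)
       #>\<^bsub>free_Abelian_group (carrier L1 \<times> carrier L2)\<^esub> Poly_Mapping.single (x, y) 1"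

definition div_prod ::
  "'a monoid \<times> ('a \<Rightarrow> real) \<Rightarrow> 'b monoid \<times> ('b \<Rightarrow> real) \<Rightarrow>
     (('a \<times> 'b) \<Rightarrow>\<^sub>0 int) set monoid \<times> ((('a \<times> 'b) \<Rightarrow>\<^sub>0 int) set \<Rightarrow> real)" where
  "div_prod D1 D2 =
     (tensor_group (fst D1) (fst D2),
      SOME N. arith_divisor (tensor_group (fst D1) (fst D2), N) \<and>
        (\<forall>x \<in> carrier (fst D1). \<forall>y \<in> carrier (fst D2).
            N (tensor_elem (fst D1) (fst D2) x y) = snd D1 x * snd D2 y))"

definition Lambda_group :: "adele \<Rightarrow> rat monoid" where
  "Lambda_group a = \<lparr>carrier = {q. afin_integral (afin_scale q (fst a))}, monoid.mult = (+), one = 0\<rparr>"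

definition Lambda :: "adele \<Rightarrow> rat monoid \<times> (rat \<Rightarrow> real)" where
  "Lambda a = (Lambda_group a, \<lambda>q. \<bar>snd a\<bar> * \<bar>real_of_rat q\<bar>)"

end

theory Submission
  imports Defs "HOL-Number_Theory.Cong"
begin

text \<open>
  For \<open>a = z/d\<close> with \<open>z\<close> a profinite integer, \<open>m/n \<in> L\<^sub>a\<close> says that \<open>n d\<close> divides \<open>m z\<close>, which is
  a condition on the residue of \<open>z\<close> modulo \<open>n d\<close> alone.  So \<open>L\<^sub>a\<close> records which integers divide \<open>z\<close>,
  that is, the gcd of \<open>z n\<close> with \<open>n\<close> for every \<open>n\<close>.  Two facts follow by compactness of the profinite
  integers: elements with the same divisors differ by a unit, since modulo each \<open>n\<close> they do; and
  every set of positive integers containing 1 and closed under divisors and least common multiples is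
  the set of divisors of some \<open>z\<close>.  As an isomorphism between subgroups of \<open>\<rat>\<close> is multiplication by a
  rational number, the first fact gives injectivity and the second gives surjectivity.

  For the product, finitely generated subgroups of \<open>\<rat>\<close> are cyclic, so every element of
  \<open>L\<^sub>a \<otimes> L\<^sub>b\<close> is a pure tensor \<open>x \<otimes> y\<close>, and multiplication \<open>x \<otimes> y \<mapsto> x y\<close> is injective.  It maps onto the lattice
  of the product adele because a divisor \<open>n\<close> of \<open>z w\<close> factors as a divisor \<open>gcd (z n) n\<close> of \<open>z\<close> times
  a divisor of \<open>w\<close>.  Purity also shows that the norm of the product is determined by its values on
  pure tensors.
\<close>

section \<open>Profinite integers\<close>

lemma zhatI:
  assumes "x 0 = 0" "\<And>n. 0 < n \<Longrightarrow> 0 \<le> x n \<and> x n < int n"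
    and "\<And>m n. \<lbrakk>0 < m; 0 < n; m dvd n\<rbrakk> \<Longrightarrow> x n mod int m = x m"
  shows "x \<in> zhat"
  using assms by (auto simp: zhat_def)

text \<open>Compactness of the profinite integers, later used to build inverses, units relating
  associates, and elements with prescribed divisors. The values \<open>v\<close> need not be
  reduced: \<open>proj\<close> with \<open>m = n\<close> replaces \<open>v\<close> by its residue,
  and finiteness of the residues is what counts.\<close>

lemma zhat_inverse_limit:
  assumes ex: "\<And>n. 0 < n \<Longrightarrow> \<exists>v. P n v"
    and proj: "\<And>m n v. \<lbrakk>0 < n; m dvd n; P n v\<rbrakk> \<Longrightarrow> P m (v mod int m)"
  shows "\<exists>z\<in>zhat. \<forall>n>0. P n (z n)"
proof -
  \<comment> \<open>Koenig's lemma along the cofinal chain of factorials: \<open>good k v\<close> means that \<open>v\<close> lifts to every higher level.\<close>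
  define good where "good k v \<longleftrightarrow> (\<forall>K\<ge>k. \<exists>v'. P (fact K) v' \<and> v' mod int (fact k) = v)"
    for k :: nat and v :: int
  have factdvd: "int (fact i) dvd int (fact j)" if "i \<le> j" for i j :: nat
    using fact_dvd[OF that, where 'a = int] by simp
  \<comment> \<open>\<open>fact 0\<close> is 1, so 0 is the only residue at the bottom level and
    existence at every level makes it good.\<close>
  have good0: "good 0 0"
    unfolding good_def using ex by auto
  have step: "\<exists>v'. good (Suc k) v' \<and> v' mod int (fact k) = v" if gd: "good k v" for k v
  proof (rule ccontr)
    assume contra: "\<not> ?thesis"
    let ?M = "{0..<int (fact (Suc k))}"
    have "\<forall>v'\<in>?M. \<exists>K. v' mod int (fact k) = v \<longrightarrow>
            K \<ge> Suc k \<and> (\<forall>w. P (fact K) w \<longrightarrow> w mod int (fact (Suc k)) \<noteq> v')"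
      using contra unfolding good_def by blast
    then obtain F where F: "\<And>v'. \<lbrakk>v' \<in> ?M; v' mod int (fact k) = v\<rbrakk> \<Longrightarrow>
            F v' \<ge> Suc k \<and> (\<forall>w. P (fact (F v')) w \<longrightarrow> w mod int (fact (Suc k)) \<noteq> v')"
      by metis
    \<comment> \<open>If every residue above \<open>v\<close> modulo \<open>fact (Suc k)\<close>
      failed, each would fail at some level \<open>fact (F v')\<close>. There are finitely many, so
      \<open>K\<close> bounds all these indices; a lift \<open>w\<close> of \<open>v\<close> at
      level \<open>fact K\<close>, projected down to \<open>fact (F v')\<close>, contradicts the
      failure of its own residue \<open>v'\<close>.\<close>
    define K where "K = Max (insert k (F ` ?M))"
    have K: "k \<le> K" "\<And>v'. v' \<in> ?M \<Longrightarrow> F v' \<le> K"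
      unfolding K_def by (intro Max_ge; simp del: fact_Suc of_nat_fact)+
    obtain w where w: "P (fact K) w" "w mod int (fact k) = v"
      using gd K(1) unfolding good_def by blast
    define v' where "v' = w mod int (fact (Suc k))"
    have v'M: "v' \<in> ?M"
      unfolding v'_def by (simp del: fact_Suc of_nat_fact)
    have v'v: "v' mod int (fact k) = v"
      unfolding v'_def using w(2) factdvd[of k "Suc k"] by (simp add: mod_mod_cancel del: fact_Suc of_nat_fact)
    have "P (fact (F v')) (w mod int (fact (F v')))"
      by (rule proj[OF _ _ w(1)]) (auto intro: fact_dvd K(2)[OF v'M])
    moreover have "w mod int (fact (F v')) mod int (fact (Suc k)) = v'"
      unfolding v'_def[symmetric] using F[OF v'M v'v]
      by (subst mod_mod_cancel[OF factdvd]) (simp_all only: v'_def)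
    ultimately show False
      using F[OF v'M v'v] by blast
  qed
  have "\<exists>c. \<forall>k. good k (c k) \<and> c (Suc k) mod int (fact k) = c k"
    by (rule dependent_nat_choice) (use good0 step in blast)+
  then obtain c where c: "\<And>k. good k (c k)" "\<And>k. c (Suc k) mod int (fact k) = c k"
    by blast
  have cmod: "c n mod int (fact m) = c m" if "m \<le> n" for m n
    using that
  proof (induction n rule: dec_induct)
    case base
    obtain v' where "v' mod int (fact m) = c m"
      using c(1)[of m] unfolding good_def by blast
    then show ?case by (metis mod_mod_trivial)
  next
    case (step n)
    have "c (Suc n) mod int (fact m) = c (Suc n) mod int (fact n) mod int (fact m)"
      using factdvd[OF step(1)] by (simp add: mod_mod_cancel del: of_nat_fact)
    then show ?case using c(2) step by simp
  qed
  have Pc: "P (fact n) (c n)" for n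
  proof -
    obtain v where v: "P (fact n) v" "v mod int (fact n) = c n"
      using c(1)[of n] unfolding good_def by blast
    then show ?thesis using proj[of "fact n" "fact n" v] by simp
  qed
  \<comment> \<open>The factorials are cofinal: \<open>n\<close> divides \<open>fact n\<close>, so
    the value at \<open>n\<close> is read off from \<open>c n\<close>. The value at 0 is the
    normalised one.\<close>
  define z where "z n = (if n = 0 then 0 else c n mod int n)" for n
  have dvdf: "n dvd fact n" if "n > 0" for n :: nat
    using that by (simp add: dvd_fact)
  have zmod: "z n mod int m = z m" if "0 < m" "0 < n" "m dvd n" for m n
  proof -
    have "m \<le> n" using that by (simp add: dvd_imp_le)
    have "z n mod int m = c n mod int m"
      using that by (simp add: z_def mod_mod_cancel)
    also have "\<dots> = c n mod int (fact m) mod int m"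
      using dvdf[OF that(1)] by (subst mod_mod_cancel) (auto simp del: of_nat_fact)
    also have "\<dots> = z m"
      using cmod[OF \<open>m \<le> n\<close>] that by (simp add: z_def)
    finally show ?thesis .
  qed
  have "z \<in> zhat"
    by (rule zhatI[OF _ _ zmod]) (simp_all add: z_def)
  moreover have "P n (z n)" if "0 < n" for n
    using proj[OF _ dvdf[OF that] Pc] that by (simp add: z_def)
  ultimately show ?thesis by blast
qed

lemma zhat_mod: "z \<in> zhat \<Longrightarrow> 0 < n \<Longrightarrow> m dvd n \<Longrightarrow> z n mod int m = z m"
  by (cases "m = 0") (auto simp: zhat_def)

lemma zhat_range: "z \<in> zhat \<Longrightarrow> 0 < n \<Longrightarrow> 0 \<le> z n \<and> z n < int n"
  by (auto simp: zhat_def)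

lemma zhat_mod_self: "z \<in> zhat \<Longrightarrow> z n mod int n = z n"
  by (cases "n = 0") (auto simp: zhat_def)

lemma zhat_cong: "z \<in> zhat \<Longrightarrow> 0 < n \<Longrightarrow> m dvd n \<Longrightarrow> [z m = z n] (mod int m)"
  using zhat_mod[of z n m] zhat_mod_self[of z m] by (simp add: cong_def)

lemma zhat_eq_0_iff: "z \<in> zhat \<Longrightarrow> z n = 0 \<longleftrightarrow> int n dvd z n"
  using zhat_mod_self[of z n] by (auto simp: dvd_eq_mod_eq_0)

lemma zmul_closed: "x \<in> zhat \<Longrightarrow> y \<in> zhat \<Longrightarrow> zmul x y \<in> zhat"
proof (rule zhatI)
  fix m n :: nat
  assume *: "x \<in> zhat" "y \<in> zhat" "0 < m" "0 < n" "m dvd n"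
  then have "zmul x y n mod int m = (x n * y n) mod int m"
    by (simp add: zmul_def mod_mod_cancel)
  also have "\<dots> = ((x n mod int m) * (y n mod int m)) mod int m"
    by (simp add: mod_mult_eq)
  finally show "zmul x y n mod int m = zmul x y m"
    using * by (simp add: zhat_mod zmul_def)
qed (auto simp: zmul_def)

lemma zint_closed: "zint k \<in> zhat"
  by (rule zhatI) (auto simp: zint_def mod_mod_cancel)

lemma zmul_cong: "n > 0 \<Longrightarrow> [zmul x y n = x n * y n] (mod int n)"
  by (simp add: zmul_def)

lemma zmul_zint_cong: "n > 0 \<Longrightarrow> [zmul (zint k) y n = k * y n] (mod int n)"
  by (simp add: zmul_def zint_def cong_def mod_mult_left_eq)

lemma zhat_ext:
  assumes "x \<in> zhat" "y \<in> zhat" "\<And>n. 0 < n \<Longrightarrow> [x n = y n] (mod int n)"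
  shows "x = y"
proof
  fix n show "x n = y n"
    using assms zhat_mod_self[of x n] zhat_mod_self[of y n]
    by (cases "n = 0") (auto simp: cong_def zhat_def)
qed

section \<open>Divisibility of profinite integers by integers\<close>

text \<open>Divisibility by \<open>d\<close> is visible at level \<open>d\<close> alone, which turns
  integrality of an adele into ordinary divisibility of one residue.\<close>

lemma afin_integral_iff:
  assumes z: "z \<in> zhat" and d: "d > 0"
  shows "afin_integral (z, d) \<longleftrightarrow> z d = 0"
proof
  assume "afin_integral (z, d)"
  then obtain w where "z = zmul (zint (int d)) w" by (auto simp: afin_integral_def)
  then show "z d = 0" by (simp add: zmul_def zint_def)
next
  assume z0: "z d = 0"
  have ddvd: "int d dvd z (d * n)" if "n > 0" for n
    using zhat_mod[OF z, of "d * n" d] d z0 that by (simp add: dvd_eq_mod_eq_0)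
  \<comment> \<open>Level \<open>d * n\<close> is the right one: its residue is a multiple of
    \<open>d\<close>, and the quotient is determined modulo \<open>n\<close>. The residue
    \<open>z n\<close> itself need not be a multiple of \<open>d\<close>.\<close>
  define w where "w n = (if n = 0 then 0 else z (d * n) div int d)" for n
  have dw: "int d * w n = z (d * n)" if "n > 0" for n
    using ddvd[OF that] that by (simp add: w_def)
  have w: "w \<in> zhat"
  proof (rule zhatI)
    fix n :: nat assume n: "0 < n"
    show "0 \<le> w n \<and> w n < int n"
      using zhat_range[OF z, of "d * n"] dw[OF n] n d
      by (metis mult_less_cancel_left_pos mult_pos_pos of_nat_0_less_iff of_nat_mult
          zero_le_mult_iff linorder_not_less)
  next
    fix m n :: nat assume mn: "0 < m" "0 < n" "m dvd n"
    have "int d * (w n mod int m) = (int d * w n) mod (int d * int m)"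
      by (rule mult_mod_right)
    also have "\<dots> = int d * w m"
      using zhat_mod[OF z, of "d * n" "d * m"] mn d by (simp add: dw)
    finally show "w n mod int m = w m" using d by simp
  qed (simp add: w_def)
  have "z = zmul (zint (int d)) w"
  proof (rule zhat_ext[OF z])
    fix n :: nat assume n: "0 < n"
    have "[zmul (zint (int d)) w n = z (d * n)] (mod int n)"
      using zmul_zint_cong[OF n, of "int d" w] dw[OF n] by simp
    moreover have "[z n = z (d * n)] (mod int n)"
      by (rule zhat_cong[OF z]) (use d n in simp_all)
    ultimately show "[z n = zmul (zint (int d)) w n] (mod int n)"
      using cong_sym cong_trans by blast
  qed (simp add: zmul_closed zint_closed w)
  then show "afin_integral (z, d)"
    using w by (auto simp: afin_integral_def)
qed

text \<open>The factor \<open>j\<close> cancels, and the residues of \<open>z\<close> at levels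
  \<open>j * n\<close> and \<open>n\<close> agree modulo \<open>n\<close>. Read in either direction,
  this changes the level at which a divisibility is tested.\<close>

lemma zhat_dvd_cancel:
  assumes z: "z \<in> zhat" and "j > 0" "n > 0"
  shows "int (j * n) dvd (int j * m) * z (j * n) \<longleftrightarrow> int n dvd m * z n"
proof -
  have "int (j * n) dvd (int j * m) * z (j * n) \<longleftrightarrow> int n dvd m * z (j * n)"
    using assms by (simp add: mult.assoc)
  also have "\<dots> \<longleftrightarrow> int n dvd m * z n"
  proof -
    have "[m * z n = m * z (j * n)] (mod int n)"
      by (intro cong_scalar_left zhat_cong[OF z]) (use assms in simp_all)
    then show ?thesis using cong_dvd_iff by blast
  qed
  finally show ?thesis .
qed

section \<open>Units and associates\<close>

text \<open>Associates in Z/n: after division by the common gcd \<open>g\<close>, both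
  \<open>a'\<close> and \<open>b'\<close> are units modulo \<open>n' = n/g\<close>, so
  \<open>b'\<close> is a unit times \<open>a'\<close> there. The unit then has to be lifted from
  modulus \<open>n'\<close> to modulus \<open>n\<close>.\<close>

lemma ex_unit_mult_cong:
  fixes a b n :: int
  assumes n: "n > 0" and g: "gcd a n = gcd b n"
  shows "\<exists>u. coprime u n \<and> [b = u * a] (mod n)"
proof -
  define g where "g = gcd a n"
  have g0: "g > 0" using n by (simp add: g_def)
  obtain a' n' where a': "a = g * a'" "n = g * n'" "coprime a' n'"
    using gcd_coprime_exists[of a n] n g0 unfolding g_def by (metis gcd_pos_int less_irrefl mult.commute)
  obtain b' n'' where b'': "b = g * b'" "n = g * n''" "coprime b' n''"
    using gcd_coprime_exists[of b n] n g0 assms(2) unfolding g_def by (metis less_irrefl mult.commute)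
  then have b': "b = g * b'" "coprime b' n'"
    using a'(2) g0 by auto
  obtain i where i: "[a' * i = 1] (mod n')"
    using cong_solve_coprime_int[OF a'(3)] by blast
  define u where "u = b' * i"
  have "coprime i n'"
    using i by (metis coprime_iff_invertible_int mult.commute)
  then have cu: "coprime u n'" using b' by (simp add: u_def)
  have "[u * a' = b' * (a' * i)] (mod n')" by (simp add: u_def ac_simps)
  also have "[b' * (a' * i) = b' * 1] (mod n')" by (intro cong_scalar_left i)
  finally have ua: "[u * a' = b'] (mod n')" by simp
  \<comment> \<open>A residue prime to \<open>n'\<close> lifts to one prime to \<open>n\<close>: add \<open>n'\<close> times the product of those primes that miss \<open>u\<close>.\<close>
  define S where "S = {p \<in> prime_factors n. \<not> p dvd u}"
  define U where "U = u + n' * \<Prod>S"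
  have finS: "finite S" by (simp add: S_def)
  have primeS: "Factorial_Ring.prime p" if "p \<in> S" for p using that by (auto simp: S_def)
  have "coprime U n"
  proof (rule coprimeI, rule ccontr)
    fix c assume c: "c dvd U" "c dvd n" "\<not> is_unit c"
    then have "c \<noteq> 0" using n by auto
    then obtain p where p: "Factorial_Ring.prime p" "p dvd c"
      using c(3) prime_divisor_exists by blast
    then have pU: "p dvd U" "p dvd n" using c by (auto intro: dvd_trans)
    have pS: "p dvd \<Prod>S \<longleftrightarrow> p \<in> S"
    proof
      assume "p dvd \<Prod>S"
      then obtain x where x: "x \<in> S" "p dvd x"
        using prime_dvd_prod_iff[OF finS p(1)] by auto
      then show "p \<in> S" using primes_dvd_imp_eq[OF p(1) primeS[OF x(1)]] by simp
    next
      assume "p \<in> S"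
      then show "p dvd \<Prod>S" using dvd_prodI[OF finS, of p "\<lambda>x. x"] by simp
    qed
    show False
    \<comment> \<open>A prime \<open>p\<close> of \<open>n\<close> divides exactly one summand of
      \<open>U\<close>: if it divides \<open>u\<close>, it misses both \<open>n'\<close> and the
      product over \<open>S\<close>; otherwise it lies in \<open>S\<close>.\<close>
    proof (cases "p dvd u")
      case True
      then have "p dvd n' * \<Prod>S" using pU(1) unfolding U_def by (simp add: dvd_add_right_iff)
      moreover have "\<not> p dvd n'"
        using True cu p(1) coprime_common_divisor not_prime_unit by blast
      ultimately have "p \<in> S" using pS p(1) by (simp add: prime_dvd_mult_iff)
      with True show False by (simp add: S_def)
    next
      case False
      then have "p \<in> S" using pU(2) p(1) n by (simp add: S_def in_prime_factors_iff)
      then have "p dvd n' * \<Prod>S" using pS by simp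
      then show False using False pU(1) unfolding U_def by (simp add: dvd_add_left_iff)
    qed
  qed
  moreover have "[b = U * a] (mod n)"
  proof -
    have "[U * a' = u * a'] (mod n')"
      by (rule cong_scalar_right) (simp add: U_def cong_def)
    then have "[U * a' = b'] (mod n')" using ua cong_trans by blast
    then have "n' dvd U * a' - b'" by (simp add: cong_iff_dvd_diff)
    then have "g * n' dvd g * (U * a' - b')" by simp
    then have "[U * a = b] (mod n)" using a' b' by (simp add: cong_iff_dvd_diff algebra_simps)
    then show ?thesis by (rule cong_sym)
  qed
  ultimately show ?thesis by blast
qed

text \<open>Coprimality gives an inverse modulo each \<open>n\<close>, and the inverse limit
  assembles these into one profinite inverse.\<close>

lemma zunits_iff_coprime:
  assumes u: "u \<in> zhat"
  shows "u \<in> zunits \<longleftrightarrow> (\<forall>n>0. coprime (u n) (int n))"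
proof
  assume "u \<in> zunits"
  then obtain v where v: "zmul u v = zint 1" by (auto simp: zunits_def)
  show "\<forall>n>0. coprime (u n) (int n)"
  proof (intro allI impI)
    fix n :: nat assume n: "n > 0"
    have "[u n * v n = 1] (mod int n)"
      using fun_cong[OF v, of n] n by (simp add: zmul_def zint_def cong_def)
    then show "coprime (u n) (int n)"
      using coprime_iff_invertible_int by blast
  qed
next
  assume cop: "\<forall>n>0. coprime (u n) (int n)"
  have "\<exists>v\<in>zhat. \<forall>n>0. [u n * v n = 1] (mod int n)"
  proof (rule zhat_inverse_limit)
    fix n :: nat assume "0 < n"
    then show "\<exists>v. [u n * v = 1] (mod int n)"
      using cop cong_solve_coprime_int by blast
  next
    fix m n :: nat and v assume mn: "0 < n" "m dvd n" "[u n * v = 1] (mod int n)"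
    then have "[u n * v = 1] (mod int m)"
      by (meson cong_dvd_modulus of_nat_dvd_iff)
    moreover have "[u m * (v mod int m) = u n * v] (mod int m)"
      by (intro cong_mult zhat_cong[OF u mn(1,2)]) simp
    ultimately show "[u m * (v mod int m) = 1] (mod int m)"
      by (rule cong_trans[rotated])
  qed
  then obtain v where v: "v \<in> zhat" "\<And>n. n > 0 \<Longrightarrow> [u n * v n = 1] (mod int n)" by blast
  have "zmul u v = zint 1"
    using v(2) by (auto simp: zmul_def zint_def cong_def)
  then show "u \<in> zunits" using u v(1) by (auto simp: zunits_def)
qed

text \<open>The gcd \<open>g\<close> of \<open>x n\<close> and \<open>n\<close> satisfies
  \<open>x g = 0\<close>, hence \<open>y g = 0\<close>, so \<open>g\<close> divides
  \<open>y n\<close>. By symmetry the gcds agree at every level, the residues differ by a unit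
  modulo each \<open>n\<close>, and compactness yields a single unit.\<close>

lemma zhat_associated:
  assumes x: "x \<in> zhat" and y: "y \<in> zhat"
    and same: "\<And>n. 0 < n \<Longrightarrow> x n = 0 \<longleftrightarrow> y n = 0"
  shows "\<exists>u\<in>zunits. y = zmul u x"
proof -
  have gcd_dvd: "gcd (x n) (int n) dvd y n"
    if x: "x \<in> zhat" and y: "y \<in> zhat" and n: "n > 0"
      and same: "\<And>n. 0 < n \<Longrightarrow> x n = 0 \<longleftrightarrow> y n = 0" for x y n
  proof -
    define g where "g = nat (gcd (x n) (int n))"
    have g: "int g = gcd (x n) (int n)" "g > 0" using n by (simp_all add: g_def)
    have "int g dvd int n" unfolding g(1) by simp
    then have gn: "g dvd n" by simp
    have "x g = 0"
      using zhat_mod[OF x n gn] g(1) by (metis dvd_imp_mod_0 gcd_dvd1)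
    then have "y g = 0" using same g(2) by simp
    then show ?thesis
      using zhat_mod[OF y n gn] g(1) by (metis dvd_eq_mod_eq_0)
  qed
  have gcds: "gcd (x n) (int n) = gcd (y n) (int n)" if "n > 0" for n
    using gcd_dvd[OF x y that same] gcd_dvd[OF y x that] same
    by (intro zdvd_antisym_nonneg) simp_all
  have "\<exists>u\<in>zhat. \<forall>n>0. coprime (u n) (int n) \<and> [y n = u n * x n] (mod int n)"
  proof (rule zhat_inverse_limit)
    fix n :: nat assume "0 < n"
    then show "\<exists>u. coprime u (int n) \<and> [y n = u * x n] (mod int n)"
      using ex_unit_mult_cong gcds by simp
  next
    fix m n :: nat and v
    assume mn: "0 < n" "m dvd n" and v: "coprime v (int n) \<and> [y n = v * x n] (mod int n)"
    have "coprime v (int m)"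
      using v mn(2) by (meson coprime_divisors dvd_refl of_nat_dvd_iff)
    moreover have "[y m = v mod int m * x m] (mod int m)"
    proof -
      have "[y n = v * x n] (mod int m)"
        using v mn(2) by (meson cong_dvd_modulus of_nat_dvd_iff)
      moreover have "[y m = y n] (mod int m)"
        by (rule zhat_cong[OF y mn])
      moreover have "[v * x n = v mod int m * x m] (mod int m)"
        by (intro cong_mult cong_sym[OF zhat_cong[OF x mn]]) simp
      ultimately show ?thesis using cong_trans by blast
    qed
    ultimately show "coprime (v mod int m) (int m) \<and> [y m = v mod int m * x m] (mod int m)"
      using mn dvd_pos_nat[of n m] by simp
  qed
  then obtain u where u: "u \<in> zhat" "\<And>n. n > 0 \<Longrightarrow> coprime (u n) (int n)"
    "\<And>n. n > 0 \<Longrightarrow> [y n = u n * x n] (mod int n)" by blast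
  then have "u \<in> zunits" by (simp add: zunits_iff_coprime)
  moreover have "y = zmul u x"
  proof (rule zhat_ext)
    fix n :: nat assume n: "0 < n"
    show "[y n = zmul u x n] (mod int n)"
      by (rule cong_trans[OF u(3) cong_sym[OF zmul_cong]]) (rule n)+
  qed (use x y u in \<open>auto intro: zmul_closed\<close>)
  ultimately show ?thesis by blast
qed

section \<open>Subgroups of the rational numbers\<close>

definition rat_subgroup :: "rat set \<Rightarrow> bool" where
  "rat_subgroup H \<longleftrightarrow> 0 \<in> H \<and> (\<forall>x\<in>H. \<forall>y\<in>H. x - y \<in> H)"

lemma rat_subgroup_uminus: "rat_subgroup H \<Longrightarrow> x \<in> H \<Longrightarrow> - x \<in> H"
  by (metis diff_0 rat_subgroup_def)

lemma rat_subgroup_add: "rat_subgroup H \<Longrightarrow> x \<in> H \<Longrightarrow> y \<in> H \<Longrightarrow> x + y \<in> H"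
  by (metis diff_minus_eq_add rat_subgroup_def rat_subgroup_uminus)

lemma rat_subgroup_int_mult:
  assumes H: "rat_subgroup H" and x: "x \<in> H"
  shows "of_int k * x \<in> H"
proof -
  have nat: "of_nat n * x \<in> H" for n
  proof (induction n)
    case 0
    then show ?case using H by (simp add: rat_subgroup_def)
  next
    case (Suc n)
    then show ?case using rat_subgroup_add[OF H x] by (simp add: distrib_right)
  qed
  show ?thesis
  proof (cases k rule: int_cases2)
    case (nonneg n)
    then show ?thesis using nat by simp
  next
    case (nonpos n)
    then show ?thesis using rat_subgroup_uminus[OF H nat] by simp
  qed
qed

lemma rat_fraction_coprime:
  fixes q :: rat
  obtains i j where "q = of_int i / of_nat j" "0 < j" "coprime i (int j)"
proof -
  obtain i k where q: "quotient_of q = (i, k)" by fastforce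
  have "q = of_int i / of_nat (nat k)" "0 < nat k" "coprime i (int (nat k))"
    using quotient_of_div[OF q] quotient_of_denom_pos[OF q] quotient_of_coprime[OF q] by simp_all
  then show ?thesis by (rule that)
qed

lemma rat_fraction:
  fixes q :: rat
  obtains i j where "q = of_int i / of_nat j" "0 < j"
  using rat_fraction_coprime that by metis

text \<open>Two rationals \<open>a/b\<close> and \<open>c/d\<close> are commensurable, and
  additivity carries the relation between their integer multiples over to the values of
  \<open>f\<close>. Hence isomorphisms of lattices are homotheties. The form without division covers
  zero arguments too.\<close>

lemma rat_subgroup_hom_linear:
  fixes f :: "rat \<Rightarrow> 'b::field_char_0"
  assumes H: "rat_subgroup H"
    and add: "\<And>x y. x \<in> H \<Longrightarrow> y \<in> H \<Longrightarrow> f (x + y) = f x + f y"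
    and x: "x \<in> H" and y: "y \<in> H"
  shows "of_rat x * f y = of_rat y * f x"
proof -
  have H0: "0 \<in> H" using H by (simp add: rat_subgroup_def)
  have f0: "f 0 = 0" using add[OF H0 H0] by simp
  have nat: "f (of_nat n * x) = of_nat n * f x" if "x \<in> H" for n x
  proof (induction n)
    case (Suc n)
    have "of_nat n * x \<in> H" using rat_subgroup_int_mult[OF H that, of "int n"] by simp
    from add[OF that this] Suc show ?case by (simp add: algebra_simps)
  qed (simp add: f0)
  have neg: "f (- x) = - f x" if "x \<in> H" for x
    using add[OF that rat_subgroup_uminus[OF H that]] f0 by (simp add: eq_neg_iff_add_eq_0 add.commute)
  have int: "f (of_int k * x) = of_int k * f x" if "x \<in> H" for k x
  proof (cases k rule: int_cases2)
    case (nonneg n)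
    then show ?thesis using nat[OF that] by simp
  next
    case (nonpos n)
    then show ?thesis
      using nat[OF that, of n] neg[OF rat_subgroup_int_mult[OF H that, of "int n"]] by simp
  qed
  obtain a b where ab: "x = of_int a / of_nat b" "0 < b" by (rule rat_fraction)
  obtain c d where cd: "y = of_int c / of_nat d" "0 < d" by (rule rat_fraction)
  have "of_int (c * int b) * x = of_int (a * int d) * y"
    unfolding ab(1) cd(1) using ab(2) cd(2) by (simp add: field_simps)
  then have "of_int (c * int b) * f x = of_int (a * int d) * f y"
    using int[OF x] int[OF y] by metis
  moreover have rx: "(of_rat x :: 'b) = of_int a / of_nat b" and ry: "(of_rat y :: 'b) = of_int c / of_nat d"
    by (simp_all add: ab(1) cd(1) of_rat_divide)
  ultimately show ?thesis unfolding rx ry using ab(2) cd(2) by (simp add: field_simps)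
qed

text \<open>Over a common denominator, Bezout writes the gcd of the numerators as a combination of
  \<open>x\<close> and \<open>y\<close>. If both are zero, the gcd and \<open>g\<close> are zero as
  well.\<close>

lemma rat_subgroup_common_generator:
  assumes H: "rat_subgroup H" and x: "x \<in> H" and y: "y \<in> H"
  obtains g i j where "g \<in> H" "x = of_int i * g" "y = of_int j * g"
proof -
  obtain a m where am: "x = of_int a / of_nat m" "0 < m" by (rule rat_fraction)
  obtain b n where bn: "y = of_int b / of_nat n" "0 < n" by (rule rat_fraction)
  define A where "A = a * int n"
  define B where "B = b * int m"
  define M :: rat where "M = of_nat (m * n)"
  have M: "M \<noteq> 0" using am bn by (simp add: M_def)
  have xA: "x = of_int A / M" and yB: "y = of_int B / M"
    using am bn by (simp_all add: A_def B_def M_def)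
  obtain u v where uv: "u * A + v * B = gcd A B" using bezout_int by blast
  obtain i where i: "A = gcd A B * i" using gcd_dvd1 by (rule dvdE)
  obtain j where j: "B = gcd A B * j" using gcd_dvd2 by (rule dvdE)
  define g where "g = of_int u * x + of_int v * y"
  have "g = of_int (u * A + v * B) / M" by (simp add: g_def xA yB add_divide_distrib)
  then have gM: "g = of_int (gcd A B) / M" by (simp only: uv)
  show thesis
  proof (rule that)
    show "g \<in> H" unfolding g_def
      by (intro rat_subgroup_add[OF H] rat_subgroup_int_mult[OF H] x y)
    have "of_int A = (of_int (gcd A B * i) :: rat)" using i by simp
    then show "x = of_int i * g" by (simp add: xA gM)
    have "of_int B = (of_int (gcd A B * j) :: rat)" using j by simp
    then show "y = of_int j * g" by (simp add: yB gM)
  qed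
qed

section \<open>The lattice of an adele\<close>

lemma Lambda_group_simps [simp]:
  "x \<otimes>\<^bsub>Lambda_group a\<^esub> y = x + y" "\<one>\<^bsub>Lambda_group a\<^esub> = 0"
  by (simp_all add: Lambda_group_def)

text \<open>The scaling in the definition uses the reduced fraction from \<open>quotient_of\<close>;
  this form accepts any fraction, so denominators can be chosen to suit each computation.\<close>

lemma Lambda_mem_iff:
  assumes z: "z \<in> zhat" and d: "d > 0" and n: "n > 0"
  shows "of_int m / of_nat n \<in> carrier (Lambda_group ((z, d), r))
     \<longleftrightarrow> int (n * d) dvd m * z (n * d)"
proof -
  obtain m' k' where q: "quotient_of (of_int m / of_nat n) = (m', k')" by fastforce
  define k where "k = nat k'"
  have k: "k > 0" "k' = int k"
    using quotient_of_denom_pos[OF q] by (auto simp: k_def)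
  have "(of_int m / of_nat n :: rat) = of_int m' / of_nat k"
    using quotient_of_div[OF q] k by simp
  then have "of_int (m * int k) = (of_int (m' * int n) :: rat)"
    using n k by (simp add: field_simps)
  then have cross: "m * int k = m' * int n" by (simp only: of_int_eq_iff)
  have "of_int m / of_nat n \<in> carrier (Lambda_group ((z, d), r))
      \<longleftrightarrow> afin_integral (zmul (zint m') z, k * d)"
    by (simp add: Lambda_group_def afin_scale_def q k)
  also have "\<dots> \<longleftrightarrow> zmul (zint m') z (k * d) = 0"
    by (intro afin_integral_iff) (use z d k in \<open>auto simp: zmul_closed zint_closed\<close>)
  also have "\<dots> \<longleftrightarrow> int (k * d) dvd zmul (zint m') z (k * d)"
    by (intro zhat_eq_0_iff zmul_closed zint_closed z)
  also have "\<dots> \<longleftrightarrow> int (k * d) dvd m' * z (k * d)"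
    by (intro cong_dvd_iff zmul_zint_cong) (use k d in auto)
  \<comment> \<open>Both conditions are raised to the common level \<open>n * k * d\<close>, where
    \<open>m * k = m' * n\<close> identifies them.\<close>
  also have "\<dots> \<longleftrightarrow> int (n * (k * d)) dvd (int n * m') * z (n * (k * d))"
    by (intro zhat_dvd_cancel[symmetric]) (use z k d n in auto)
  also have "\<dots> \<longleftrightarrow> int (k * (n * d)) dvd (int k * m) * z (k * (n * d))"
    using cross by (simp add: ac_simps)
  also have "\<dots> \<longleftrightarrow> int (n * d) dvd m * z (n * d)"
    by (intro zhat_dvd_cancel) (use z k d n in auto)
  finally show ?thesis .
qed

lemma Lambda_rat_subgroup:
  assumes "a \<in> adeles"
  shows "rat_subgroup (carrier (Lambda_group a))"
proof -
  obtain z d r where a: "a = ((z, d), r)" "z \<in> zhat" "d > 0"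
    using assms by (auto simp: adeles_def)
  note mem = Lambda_mem_iff[OF a(2,3), of _ _ r]
  have "0 \<in> carrier (Lambda_group a)"
    using mem[of 1 0] a by simp
  moreover have "x - y \<in> carrier (Lambda_group a)"
    if "x \<in> carrier (Lambda_group a)" "y \<in> carrier (Lambda_group a)" for x y
  proof -
    obtain i j where x: "x = of_int i / of_nat j" "0 < j" by (rule rat_fraction)
    obtain k l where y: "y = of_int k / of_nat l" "0 < l" by (rule rat_fraction)
    have x': "x = of_int (i * int l) / of_nat (j * l)" and y': "y = of_int (k * int j) / of_nat (j * l)"
      and xy: "x - y = of_int (i * int l - k * int j) / of_nat (j * l)"
      unfolding x(1) y(1) using x(2) y(2) by (simp_all add: field_simps)
    have jl: "0 < j * l" using x y by simp
    show ?thesis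
      using that mem[OF jl] unfolding xy unfolding x' y' a(1)
      by (metis dvd_diff left_diff_distrib)
  qed
  ultimately show ?thesis by (simp add: rat_subgroup_def)
qed

text \<open>Clearing the denominator of \<open>z/d\<close> leaves the integral element
  \<open>z\<close>. This makes the lattice nonzero even for \<open>z = 0\<close>.\<close>

lemma denominator_mem_Lambda:
  assumes "((z, d), r) \<in> adeles"
  shows "of_nat d \<in> carrier (Lambda_group ((z, d), r))"
  using Lambda_mem_iff[of z d 1 "int d" r] assms by (simp add: adeles_def)

lemma Lambda_nonzero_mem:
  assumes "a \<in> adeles"
  obtains x where "x \<in> carrier (Lambda_group a)" "x \<noteq> 0"
proof -
  obtain z d r where a: "a = ((z, d), r)" "d > 0"
    using assms by (auto simp: adeles_def)
  then show ?thesis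
    using that[of "of_nat d"] denominator_mem_Lambda assms by simp
qed

section \<open>Classes of adeles and isomorphisms of lattices\<close>

text \<open>The shape of a unit times a rational multiple of an adele, once \<open>adele_eq\<close>
  has cleared denominators: \<open>m\<close> is the numerator of the rational and \<open>c\<close>
  the denominator of the other adele.\<close>

lemma zmul_zint_zmul_cong:
  assumes n: "n > 0"
  shows "[zmul (zint c) (zmul u (zmul (zint m) z)) n = u n * (c * m * z n)] (mod int n)"
proof -
  have "[zmul (zint c) (zmul u (zmul (zint m) z)) n = c * zmul u (zmul (zint m) z) n] (mod int n)"
    by (rule zmul_zint_cong[OF n])
  also have "[c * zmul u (zmul (zint m) z) n = c * (u n * zmul (zint m) z n)] (mod int n)"
    by (intro cong_scalar_left zmul_cong n)
  also have "[c * (u n * zmul (zint m) z n) = c * (u n * (m * z n))] (mod int n)"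
    by (intro cong_scalar_left zmul_zint_cong n)
  finally show ?thesis by (simp add: ac_simps)
qed

text \<open>With \<open>b = u q a\<close>, integrality of \<open>p b\<close> is that of
  \<open>p q a\<close>, because \<open>u\<close> is prime to every modulus.\<close>

lemma Lambda_carrier_scale:
  assumes a: "a \<in> adeles" and b: "b \<in> adeles" and u: "u \<in> zunits"
    and eq: "adele_eq b (adele_unit u (adele_scale q a))"
  shows "p \<in> carrier (Lambda_group b) \<longleftrightarrow> p * q \<in> carrier (Lambda_group a)"
proof -
  obtain z d r where za: "a = ((z, d), r)" "z \<in> zhat" "d > 0" using a by (auto simp: adeles_def)
  obtain w e s where wb: "b = ((w, e), s)" "w \<in> zhat" "e > 0" using b by (auto simp: adeles_def)
  obtain m k' where q: "quotient_of q = (m, k')" by fastforce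
  define k where "k = nat k'"
  have k: "k > 0" "k' = int k" using quotient_of_denom_pos[OF q] by (auto simp: k_def)
  have qmk: "q = of_int m / of_nat k" using quotient_of_div[OF q] k by simp
  have uz: "u \<in> zhat" using u by (simp add: zunits_def)
  have weq: "zmul (zint (int (k * d))) w = zmul (zint (int e)) (zmul u (zmul (zint m) z))"
    using eq by (simp add: adele_eq_def afin_eq_def adele_unit_def adele_scale_def afin_scale_def q za wb k)
  have cong: "[int (k * d) * w n = u n * (int e * m * z n)] (mod int n)" if n: "n > 0" for n
  proof -
    have "[int (k * d) * w n = zmul (zint (int e)) (zmul u (zmul (zint m) z)) n] (mod int n)"
      using zmul_zint_cong[OF n, of "int (k * d)" w] unfolding weq by (rule cong_sym)
    then show ?thesis
      using zmul_zint_zmul_cong[OF n] by (rule cong_trans)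
  qed
  obtain i j where ij: "p = of_int i / of_nat j" "0 < j" by (rule rat_fraction)
  \<comment> \<open>A level divisible by all denominators in play, so that the equation between
    \<open>w\<close> and \<open>z\<close> is used once, as a congruence modulo
    \<open>M\<close>.\<close>
  define M where "M = k * d * (j * e)"
  have M: "M > 0" using k za wb ij by (simp add: M_def)
  have "p \<in> carrier (Lambda_group b) \<longleftrightarrow> int (j * e) dvd i * w (j * e)"
    unfolding ij(1) wb(1) by (rule Lambda_mem_iff) (use wb ij in auto)
  also have "\<dots> \<longleftrightarrow> int M dvd (int (k * d) * i) * w M"
    unfolding M_def by (rule zhat_dvd_cancel[symmetric]) (use za wb ij k in auto)
  also have "\<dots> \<longleftrightarrow> int M dvd i * (int (k * d) * w M)"
    by (simp add: ac_simps)
  also have "\<dots> \<longleftrightarrow> int M dvd i * (u M * (int e * m * z M))"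
    by (intro cong_dvd_iff cong_scalar_left cong M)
  also have "\<dots> \<longleftrightarrow> int M dvd u M * (i * (int e * m * z M))"
    by (simp add: ac_simps)
  also have "\<dots> \<longleftrightarrow> int M dvd i * (int e * m * z M)"
    using u uz M zunits_iff_coprime[OF uz]
    by (intro coprime_dvd_mult_right_iff) (simp add: coprime_commute)
  also have "\<dots> \<longleftrightarrow> int (e * ((j * k) * d)) dvd (int e * (i * m)) * z (e * ((j * k) * d))"
    by (simp add: M_def ac_simps)
  also have "\<dots> \<longleftrightarrow> int ((j * k) * d) dvd (i * m) * z ((j * k) * d)"
    by (rule zhat_dvd_cancel) (use za wb ij k in auto)
  also have "\<dots> \<longleftrightarrow> of_int (i * m) / of_nat (j * k) \<in> carrier (Lambda_group a)"
    unfolding za(1) by (rule Lambda_mem_iff[symmetric]) (use za ij k in auto)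
  also have "of_int (i * m) / of_nat (j * k) = p * q"
    using ij qmk by simp
  finally show ?thesis .
qed

text \<open>The lattice determines the finite adele up to a unit: written over one denominator, the
  finite parts of \<open>b\<close> and \<open>q a\<close> have numerators with the same integer
  divisors, so \<open>zhat_associated\<close> applies.\<close>

lemma XQ_rel_if_carrier_scale:
  assumes a: "a \<in> adeles" and b: "b \<in> adeles" and q0: "q \<noteq> 0"
    and snd_eq: "snd b = real_of_rat q * snd a"
    and scale: "\<And>p. p \<in> carrier (Lambda_group b) \<longleftrightarrow> p * q \<in> carrier (Lambda_group a)"
  shows "XQ_rel a b"
proof -
  obtain z d r where za: "a = ((z, d), r)" "z \<in> zhat" "d > 0" using a by (auto simp: adeles_def)
  obtain w e s where wb: "b = ((w, e), s)" "w \<in> zhat" "e > 0" using b by (auto simp: adeles_def)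
  obtain m k' where q: "quotient_of q = (m, k')" by fastforce
  define k where "k = nat k'"
  have k: "k > 0" "k' = int k" using quotient_of_denom_pos[OF q] by (auto simp: k_def)
  have qmk: "q = of_int m / of_nat k" using quotient_of_div[OF q] k by simp
  \<comment> \<open>The numerators of \<open>q a\<close> and of \<open>b\<close> over the common
    denominator \<open>k * d * e\<close>.\<close>
  define x where "x = zmul (zint (int e * m)) z"
  define y where "y = zmul (zint (int (k * d))) w"
  have xy: "x \<in> zhat" "y \<in> zhat"
    using za wb by (simp_all add: x_def y_def zmul_closed zint_closed)
  have zero_iff: "zmul (zint c) v n = 0 \<longleftrightarrow> int n dvd c * v n" if "v \<in> zhat" "n > 0" for c v n
    using zhat_eq_0_iff[OF zmul_closed[OF zint_closed that(1)], of c n]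
      cong_dvd_iff[OF zmul_zint_cong[OF that(2)], of c v] by simp
  have "x n = 0 \<longleftrightarrow> y n = 0" if n: "n > 0" for n
  proof -
    have "y n = 0 \<longleftrightarrow> int n dvd int (k * d) * w n"
      unfolding y_def by (rule zero_iff[OF wb(2) n])
    also have "\<dots> \<longleftrightarrow> int (e * n) dvd (int e * int (k * d)) * w (e * n)"
      by (rule zhat_dvd_cancel[symmetric]) (use wb n in auto)
    also have "\<dots> \<longleftrightarrow> int (n * e) dvd (int e * int (k * d)) * w (n * e)"
      by (simp add: mult.commute)
    \<comment> \<open>The test element \<open>p = e * k * d / n\<close> is chosen so that
      \<open>p b = y / n\<close> and \<open>p q a = x / n\<close>.\<close>
    also have "\<dots> \<longleftrightarrow> of_int (int e * int (k * d)) / of_nat n \<in> carrier (Lambda_group b)"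
      unfolding wb(1) by (rule Lambda_mem_iff[symmetric]) (use wb n in auto)
    also have "\<dots> \<longleftrightarrow> of_int (int e * int (k * d)) / of_nat n * q \<in> carrier (Lambda_group a)"
      by (rule scale)
    also have "of_int (int e * int (k * d)) / of_nat n * q = of_int (int d * (int e * m)) / of_nat n"
      using k by (simp add: qmk)
    also have "\<dots> \<in> carrier (Lambda_group a) \<longleftrightarrow> int (n * d) dvd (int d * (int e * m)) * z (n * d)"
      unfolding za(1) by (rule Lambda_mem_iff) (use za n in auto)
    also have "\<dots> \<longleftrightarrow> int (d * n) dvd (int d * (int e * m)) * z (d * n)"
      by (simp add: mult.commute)
    also have "\<dots> \<longleftrightarrow> int n dvd (int e * m) * z n"
      by (rule zhat_dvd_cancel) (use za n in auto)
    also have "\<dots> \<longleftrightarrow> x n = 0"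
      unfolding x_def by (rule zero_iff[OF za(2) n, symmetric])
    finally show ?thesis by simp
  qed
  then obtain u where u: "u \<in> zunits" "y = zmul u x"
    using zhat_associated[OF xy] by blast
  have uz: "u \<in> zhat" using u by (simp add: zunits_def)
  have "zmul (zint (int (k * d))) w = zmul (zint (int e)) (zmul u (zmul (zint m) z))"
  proof (rule zhat_ext)
    fix n :: nat assume n: "0 < n"
    have "[zmul (zint (int (k * d))) w n = u n * x n] (mod int n)"
      using zmul_cong[OF n, of u x] unfolding u(2)[symmetric] y_def .
    also have "[u n * x n = u n * (int e * m * z n)] (mod int n)"
      unfolding x_def by (intro cong_scalar_left zmul_zint_cong n)
    also have "[u n * (int e * m * z n) = zmul (zint (int e)) (zmul u (zmul (zint m) z)) n] (mod int n)"
      by (rule cong_sym[OF zmul_zint_zmul_cong[OF n]])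
    finally show "[zmul (zint (int (k * d))) w n = zmul (zint (int e)) (zmul u (zmul (zint m) z)) n] (mod int n)" .
  qed (use za wb uz in \<open>auto simp: zmul_closed zint_closed\<close>)
  then have "adele_eq b (adele_unit u (adele_scale q a))"
    using snd_eq by (simp add: adele_eq_def afin_eq_def adele_unit_def adele_scale_def afin_scale_def q za wb k)
  then show ?thesis using q0 u(1) by (auto simp: XQ_rel_def)
qed

text \<open>If \<open>b = u q a\<close>, division by \<open>q\<close> is the isometry. Conversely an
  isometry is multiplication by some rational \<open>c\<close>, and \<open>q\<close> is
  \<open>1/c\<close> up to a sign fixed by the real components.\<close>

lemma XQ_rel_iff_div_iso:
  assumes a: "a \<in> adeles" and b: "b \<in> adeles"
  shows "XQ_rel a b \<longleftrightarrow> div_iso (Lambda a) (Lambda b)"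
proof
  assume "XQ_rel a b"
  then obtain q u where q0: "q \<noteq> 0" and u: "u \<in> zunits"
    and eq: "adele_eq b (adele_unit u (adele_scale q a))" by (auto simp: XQ_rel_def)
  note scale = Lambda_carrier_scale[OF a b u eq]
  have snd_eq: "snd b = real_of_rat q * snd a"
    using eq by (simp add: adele_eq_def adele_unit_def adele_scale_def)
  define \<psi> where "\<psi> p = p / q" for p
  have "\<psi> \<in> iso (Lambda_group a) (Lambda_group b)"
  proof -
    have "bij_betw \<psi> (carrier (Lambda_group a)) (carrier (Lambda_group b))"
      by (rule bij_betw_byWitness[where f' = "\<lambda>p. p * q"]) (use q0 in \<open>auto simp: \<psi>_def scale\<close>)
    moreover have "\<psi> \<in> hom (Lambda_group a) (Lambda_group b)"
      by (rule homI) (use q0 in \<open>auto simp: \<psi>_def scale add_divide_distrib\<close>)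
    ultimately show ?thesis by (simp add: iso_def)
  qed
  moreover have "\<bar>snd b\<bar> * \<bar>real_of_rat (\<psi> p)\<bar> = \<bar>snd a\<bar> * \<bar>real_of_rat p\<bar>" for p
    using q0 by (simp add: snd_eq \<psi>_def of_rat_divide abs_mult)
  ultimately show "div_iso (Lambda a) (Lambda b)"
    by (auto simp: div_iso_def Lambda_def)
next
  assume "div_iso (Lambda a) (Lambda b)"
  then obtain \<psi> where iso: "\<psi> \<in> iso (Lambda_group a) (Lambda_group b)"
    and norm: "\<And>x. x \<in> carrier (Lambda_group a) \<Longrightarrow>
      \<bar>snd b\<bar> * \<bar>real_of_rat (\<psi> x)\<bar> = \<bar>snd a\<bar> * \<bar>real_of_rat x\<bar>"
    by (auto simp: div_iso_def Lambda_def)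
  have bij: "bij_betw \<psi> (carrier (Lambda_group a)) (carrier (Lambda_group b))"
    and hom: "\<psi> \<in> hom (Lambda_group a) (Lambda_group b)"
    using iso by (auto simp: iso_def)
  obtain x0 where x0: "x0 \<in> carrier (Lambda_group a)" "x0 \<noteq> 0" by (rule Lambda_nonzero_mem[OF a])
  define c where "c = \<psi> x0 / x0"
  have \<psi>: "\<psi> x = c * x" if x: "x \<in> carrier (Lambda_group a)" for x
    using rat_subgroup_hom_linear[OF Lambda_rat_subgroup[OF a], of \<psi> x x0] hom_mult[OF hom] x x0
    by (simp add: c_def field_simps)
  have zero: "0 \<in> carrier (Lambda_group a)"
    using Lambda_rat_subgroup[OF a] by (simp add: rat_subgroup_def)
  have c0: "c \<noteq> 0"
    using bij_betw_imp_inj_on[OF bij] x0 zero \<psi>[OF x0(1)] \<psi>[OF zero]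
    by (metis inj_onD mult_zero_left)
  have img: "carrier (Lambda_group b) = (\<lambda>x. c * x) ` carrier (Lambda_group a)"
    using bij_betw_imp_surj_on[OF bij] \<psi> by (metis image_cong)
  have scale: "p \<in> carrier (Lambda_group b) \<longleftrightarrow> p * (1 / c) \<in> carrier (Lambda_group a)" for p
  proof
    assume "p * (1 / c) \<in> carrier (Lambda_group a)"
    then have "c * (p * (1 / c)) \<in> carrier (Lambda_group b)" unfolding img by blast
    then show "p \<in> carrier (Lambda_group b)" using c0 by simp
  qed (use c0 img in auto)
  \<comment> \<open>Norms determine the real components only up to sign. A lattice is stable under
    negation, so \<open>- 1 / c\<close> is equally available when the signs disagree.\<close>
  have scale': "p \<in> carrier (Lambda_group b) \<longleftrightarrow> p * (- 1 / c) \<in> carrier (Lambda_group a)" for p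
    using scale[of p] scale[of "- p"] rat_subgroup_uminus[OF Lambda_rat_subgroup[OF b], of p]
      rat_subgroup_uminus[OF Lambda_rat_subgroup[OF b], of "- p"] by auto
  have "\<bar>snd b * real_of_rat c\<bar> = \<bar>snd a\<bar>"
    using norm[OF x0(1)] \<psi>[OF x0(1)] x0(2) by (simp add: abs_mult of_rat_mult)
  then consider "snd b * real_of_rat c = snd a" | "snd b * real_of_rat c = - snd a"
    by (auto simp: abs_eq_iff)
  then show "XQ_rel a b"
  proof cases
    case 1
    then show ?thesis
      by (intro XQ_rel_if_carrier_scale[OF a b _ _ scale])
         (use c0 in \<open>auto simp: of_rat_divide field_simps\<close>)
  next
    case 2
    then show ?thesis
      by (intro XQ_rel_if_carrier_scale[OF a b _ _ scale'])
         (use c0 in \<open>auto simp: of_rat_divide of_rat_minus field_simps\<close>)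
  qed
qed

section \<open>Arithmetic divisors\<close>

text \<open>Translates multiplicative powers into integer multiples, for \<open>Lambda_group\<close>
  and \<open>real_add_group\<close> alike.\<close>

lemma additive_group_int_pow:
  fixes G :: "'b::ring_1 monoid"
  assumes G: "group G" and add: "\<And>x y. x \<otimes>\<^bsub>G\<^esub> y = x + y" and zero: "\<one>\<^bsub>G\<^esub> = 0"
    and x: "x \<in> carrier G"
  shows "x [^]\<^bsub>G\<^esub> (k::int) = of_int k * x"
proof -
  interpret G: group G by (rule G)
  have nat: "x [^]\<^bsub>G\<^esub> (n::nat) = of_nat n * x" for n
    by (induction n) (simp_all add: add zero distrib_right add.commute)
  have inv: "inv\<^bsub>G\<^esub> y = - y" if "y \<in> carrier G" for y
    using G.l_inv[OF that] by (simp add: add zero eq_neg_iff_add_eq_0)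
  show ?thesis
  proof (cases k rule: int_cases2)
    case (nonneg n)
    then show ?thesis by (simp add: int_pow_int nat)
  next
    case (nonpos n)
    have "x [^]\<^bsub>G\<^esub> k = inv\<^bsub>G\<^esub> (x [^]\<^bsub>G\<^esub> n)"
      using nonpos G.int_pow_neg_int[OF x] by simp
    then show ?thesis
      using inv[OF G.nat_pow_closed[OF x, of n]] nonpos by (simp add: nat)
  qed
qed

lemma comm_group_real_add: "comm_group real_add_group"
proof (rule comm_groupI)
  fix x assume "x \<in> carrier real_add_group"
  show "\<exists>y\<in>carrier real_add_group. y \<otimes>\<^bsub>real_add_group\<^esub> x = \<one>\<^bsub>real_add_group\<^esub>"
    by (rule bexI[of _ "- x"]) (simp_all add: real_add_group_def)
qed (simp_all add: real_add_group_def)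

lemma comm_group_Lambda:
  assumes a: "a \<in> adeles"
  shows "comm_group (Lambda_group a)"
proof (rule comm_groupI)
  note H = Lambda_rat_subgroup[OF a]
  fix x y assume x: "x \<in> carrier (Lambda_group a)" and y: "y \<in> carrier (Lambda_group a)"
  show "x \<otimes>\<^bsub>Lambda_group a\<^esub> y \<in> carrier (Lambda_group a)"
    using rat_subgroup_add[OF H x y] by simp
  show "\<exists>y\<in>carrier (Lambda_group a). y \<otimes>\<^bsub>Lambda_group a\<^esub> x = \<one>\<^bsub>Lambda_group a\<^esub>"
    by (rule bexI[of _ "- x"]) (simp_all add: rat_subgroup_uminus[OF H x])
qed (use Lambda_rat_subgroup[OF a] in \<open>simp_all add: rat_subgroup_def\<close>)

lemma Lambda_int_pow:
  assumes "a \<in> adeles" "x \<in> carrier (Lambda_group a)"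
  shows "x [^]\<^bsub>Lambda_group a\<^esub> (k::int) = of_int k * x"
  using additive_group_int_pow[of "Lambda_group a" x k] comm_group_Lambda[OF assms(1)] assms(2)
  by (simp add: comm_group_def)

text \<open>The embedding of the rationals in the reals serves as \<phi>, with the absolute value of
  the real component as the scaling factor.\<close>

lemma arith_divisor_Lambda:
  assumes a: "a \<in> adeles"
  shows "arith_divisor (Lambda a)"
proof -
  obtain x0 where x0: "x0 \<in> carrier (Lambda_group a)" "x0 \<noteq> 0" by (rule Lambda_nonzero_mem[OF a])
  have rank: "\<exists>(m::int) (n::int). (m \<noteq> 0 \<or> n \<noteq> 0) \<and> of_int m * x + of_int n * y = 0" for x y :: rat
  \<comment> \<open>For \<open>y = 0\<close> the cross-multiplied coefficients used below could both
    vanish.\<close>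
  proof (cases "y = 0")
    case True
    then show ?thesis by (intro exI[of _ 0] exI[of _ 1]) simp
  next
    case False
    obtain i j where x: "x = of_int i / of_nat j" "0 < j" by (rule rat_fraction)
    obtain k l where y: "y = of_int k / of_nat l" "0 < l" by (rule rat_fraction)
    have "of_int (k * int j) * x + of_int (- (i * int l)) * y = 0"
      unfolding x(1) y(1) using x(2) y(2) by simp
    moreover have "k * int j \<noteq> 0" using False x y by auto
    ultimately show ?thesis by blast
  qed
  have "torsion_free_rank1 (Lambda_group a)"
    unfolding torsion_free_rank1_def
    using comm_group_Lambda[OF a] x0 rank by (auto simp: Lambda_int_pow[OF a])
  moreover have "real_of_rat \<in> hom (Lambda_group a) real_add_group"
    by (rule homI) (simp_all add: real_add_group_def of_rat_add)
  moreover have "inj_on real_of_rat (carrier (Lambda_group a))"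
    by (simp add: inj_on_def)
  ultimately show ?thesis
    unfolding arith_divisor_def Lambda_def fst_conv snd_conv
    by (intro conjI exI[of _ real_of_rat] exI[of _ "\<bar>snd a\<bar>"]) auto
qed

text \<open>Transport of structure. It later equips the tensor product of two lattices with a norm,
  so that the choice in \<open>div_prod\<close> has a witness.\<close>

lemma arith_divisor_iso:
  assumes D: "arith_divisor (G, N)" and \<psi>: "\<psi> \<in> iso G H" and H: "group H"
    and N': "\<And>x. x \<in> carrier G \<Longrightarrow> N' (\<psi> x) = N x"
  shows "arith_divisor (H, N')"
proof -
  have tf: "torsion_free_rank1 G" using D by (simp add: arith_divisor_def)
  then interpret G: comm_group G by (simp add: torsion_free_rank1_def)
  interpret H: group H by (rule H)
  have hom: "\<psi> \<in> hom G H" and img: "\<psi> ` carrier G = carrier H"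
    using \<psi> by (auto simp: iso_def bij_betw_def)
  interpret \<psi>: group_hom G H \<psi> by unfold_locales (rule hom)
  have one: "\<psi> x = \<one>\<^bsub>H\<^esub> \<longleftrightarrow> x = \<one>\<^bsub>G\<^esub>" if "x \<in> carrier G" for x
    using \<psi> that \<psi>.hom_one unfolding iso_def bij_betw_def
    by (metis (no_types, lifting) G.one_closed inj_on_eq_iff mem_Collect_eq)
  have "comm_group H"
    using \<psi> G.iso_imp_comm_group[of H] by (auto simp: is_iso_def H.monoid_axioms)
  moreover have "\<forall>y\<in>carrier H. \<forall>n::int. n \<noteq> 0 \<and> y [^]\<^bsub>H\<^esub> n = \<one>\<^bsub>H\<^esub> \<longrightarrow> y = \<one>\<^bsub>H\<^esub>"
  proof (intro ballI allI impI)
    fix y and n :: int assume "y \<in> carrier H" and n: "n \<noteq> 0 \<and> y [^]\<^bsub>H\<^esub> n = \<one>\<^bsub>H\<^esub>"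
    then obtain x where x: "x \<in> carrier G" "y = \<psi> x" using img by blast
    then have "x [^]\<^bsub>G\<^esub> n = \<one>\<^bsub>G\<^esub>"
      using n one[of "x [^]\<^bsub>G\<^esub> n"] \<psi>.hom_int_pow[of x n] by simp
    then have "x = \<one>\<^bsub>G\<^esub>" using tf n x unfolding torsion_free_rank1_def by blast
    then show "y = \<one>\<^bsub>H\<^esub>" using x by simp
  qed
  moreover have "\<exists>y\<in>carrier H. y \<noteq> \<one>\<^bsub>H\<^esub>"
    using tf one unfolding torsion_free_rank1_def by (metis \<psi>.hom_closed)
  moreover have "\<forall>y\<in>carrier H. \<forall>y'\<in>carrier H. \<exists>(m::int) (n::int). (m \<noteq> 0 \<or> n \<noteq> 0) \<and>
           y [^]\<^bsub>H\<^esub> m \<otimes>\<^bsub>H\<^esub> y' [^]\<^bsub>H\<^esub> n = \<one>\<^bsub>H\<^esub>"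
  proof (intro ballI)
    fix y y' assume "y \<in> carrier H" "y' \<in> carrier H"
    then obtain x x' where x: "x \<in> carrier G" "y = \<psi> x" "x' \<in> carrier G" "y' = \<psi> x'" using img by blast
    then obtain m n :: int where mn: "m \<noteq> 0 \<or> n \<noteq> 0" "x [^]\<^bsub>G\<^esub> m \<otimes>\<^bsub>G\<^esub> x' [^]\<^bsub>G\<^esub> n = \<one>\<^bsub>G\<^esub>"
      using tf unfolding torsion_free_rank1_def by blast
    have "\<psi> (x [^]\<^bsub>G\<^esub> m \<otimes>\<^bsub>G\<^esub> x' [^]\<^bsub>G\<^esub> n) = \<one>\<^bsub>H\<^esub>" using mn(2) by simp
    then have "y [^]\<^bsub>H\<^esub> m \<otimes>\<^bsub>H\<^esub> y' [^]\<^bsub>H\<^esub> n = \<one>\<^bsub>H\<^esub>"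
      using x by (simp add: \<psi>.hom_int_pow)
    then show "\<exists>(m::int) (n::int). (m \<noteq> 0 \<or> n \<noteq> 0) \<and> y [^]\<^bsub>H\<^esub> m \<otimes>\<^bsub>H\<^esub> y' [^]\<^bsub>H\<^esub> n = \<one>\<^bsub>H\<^esub>"
      using mn(1) by blast
  qed
  ultimately have "torsion_free_rank1 H" by (simp add: torsion_free_rank1_def)
  moreover obtain f lam where f: "f \<in> hom G real_add_group" "inj_on f (carrier G)" "0 \<le> lam"
    "\<And>x. x \<in> carrier G \<Longrightarrow> N x = lam * \<bar>f x\<bar>"
    using D by (auto simp: arith_divisor_def)
  let ?\<phi> = "inv_into (carrier G) \<psi>"
  have \<phi>: "?\<phi> \<in> iso H G" by (rule G.iso_set_sym[OF \<psi>])
  have "f \<circ> ?\<phi> \<in> hom H real_add_group"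
    using \<phi> f(1) by (auto simp: iso_def intro: hom_compose)
  moreover have "inj_on (f \<circ> ?\<phi>) (carrier H)"
    using \<phi> f(2) by (auto simp: iso_def bij_betw_def intro: comp_inj_on)
  moreover have "N' y = lam * \<bar>(f \<circ> ?\<phi>) y\<bar>" if "y \<in> carrier H" for y
  proof -
    have y: "?\<phi> y \<in> carrier G" "\<psi> (?\<phi> y) = y"
      using that img by (auto intro: inv_into_into f_inv_into_f)
    then show ?thesis using N'[OF y(1)] f(4)[OF y(1)] by simp
  qed
  ultimately show ?thesis
    unfolding arith_divisor_def fst_conv snd_conv using f(3) by blast
qed

section \<open>Realising arithmetic divisors by adeles\<close>

text \<open>At level \<open>n\<close> the largest divisor \<open>g\<close> of \<open>n\<close> in
  \<open>S\<close> serves as residue: closure under lcm makes every divisor of \<open>n\<close> in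
  \<open>S\<close> divide \<open>g\<close>, and closure under divisors gives the converse.\<close>

lemma ex_zhat_divisors_iff:
  assumes one: "S 1" and down: "\<And>m n. \<lbrakk>m dvd n; S n\<rbrakk> \<Longrightarrow> S m"
    and lcm: "\<And>m n. \<lbrakk>S m; S n\<rbrakk> \<Longrightarrow> S (lcm m n)"
  shows "\<exists>z\<in>zhat. \<forall>n>0. z n = 0 \<longleftrightarrow> S n"
proof -
  \<comment> \<open>The condition concerns all divisors of \<open>n\<close>, not only
    \<open>n\<close> itself, so that it survives reduction to lower levels.\<close>
  have "\<exists>z\<in>zhat. \<forall>n>0. \<forall>m. m dvd n \<longrightarrow> (int m dvd z n \<longleftrightarrow> S m)"
  proof (rule zhat_inverse_limit)
    fix n :: nat assume n: "0 < n"
    define g where "g = Max {m. m dvd n \<and> S m}"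
    have fin: "finite {m. m dvd n \<and> S m}" using n by (simp add: finite_divisors_nat)
    have "g \<in> {m. m dvd n \<and> S m}"
      unfolding g_def by (rule Max_in[OF fin]) (use one in auto)
    then have g: "g dvd n" "S g" by auto
    have "int m dvd int g \<longleftrightarrow> S m" if m: "m dvd n" for m
    proof
      assume "S m"
      then have "lcm m g \<le> g"
        using Max_ge[OF fin, folded g_def, of "lcm m g"] m g lcm by simp
      moreover have "0 < lcm m g" using m g n by (auto simp: lcm_pos_nat dvd_pos_nat)
      ultimately have "lcm m g = g" by (meson dvd_imp_le dvd_lcm2 le_antisym)
      then have "m dvd g" by (metis dvd_lcm1)
      then show "int m dvd int g" by simp
    qed (use g down in auto)
    then show "\<exists>v. \<forall>m. m dvd n \<longrightarrow> (int m dvd v \<longleftrightarrow> S m)" by blast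
  next
    fix m n :: nat and v
    assume mn: "0 < n" "m dvd n" and v: "\<forall>k. k dvd n \<longrightarrow> (int k dvd v \<longleftrightarrow> S k)"
    show "\<forall>k. k dvd m \<longrightarrow> (int k dvd v mod int m \<longleftrightarrow> S k)"
    proof (intro allI impI)
      fix k assume k: "k dvd m"
      then have "int k dvd v mod int m \<longleftrightarrow> int k dvd v" by (simp add: dvd_mod_iff)
      then show "int k dvd v mod int m \<longleftrightarrow> S k" using v k mn dvd_trans by blast
    qed
  qed
  then show ?thesis using zhat_eq_0_iff by (metis dvd_refl)
qed

text \<open>Since 1 lies in \<open>H\<close>, Bezout shows that a reduced fraction
  \<open>i/j\<close> is in \<open>H\<close> exactly when \<open>1/j\<close> is. So \<open>H\<close>
  is determined by its unit fractions, whose denominators form a set \<open>S\<close> closed under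
  divisors and lcm.\<close>

lemma ex_Lambda_carrier:
  assumes H: "rat_subgroup H" and one: "1 \<in> H"
  shows "\<exists>z\<in>zhat. \<forall>r. carrier (Lambda_group ((z, 1), r)) = H"
proof -
  define S where "S n \<longleftrightarrow> n > 0 \<and> 1 / of_nat n \<in> H" for n
  have lcm: "S (lcm m n)" if "S m" "S n" for m n
  proof -
    have mn: "m > 0" "n > 0" using that by (auto simp: S_def)
    obtain u v where uv: "u * int m + v * int n = gcd (int m) (int n)"
      using bezout_int by blast
    have "int (lcm m n) * int (gcd m n) = int m * int n"
      by (metis of_nat_mult prod_gcd_lcm_nat mult.commute)
    then have "of_nat (lcm m n) * of_nat (gcd m n) = (of_nat m * of_nat n :: rat)"
      by (metis of_nat_mult of_nat_eq_iff)
    moreover have "of_nat (gcd m n) = (of_int u * of_nat m + of_int v * of_nat n :: rat)"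
    proof -
      have "of_int (u * int m + v * int n) = (of_int (int (gcd m n)) :: rat)" using uv by simp
      then show ?thesis by simp
    qed
    moreover have "lcm m n > 0" using mn by (simp add: lcm_pos_nat)
    \<comment> \<open>Bezout divided by \<open>m * n\<close>: the left side becomes the reciprocal
      of the lcm.\<close>
    ultimately have "1 / of_nat (lcm m n) = (of_int u * (1 / of_nat n) + of_int v * (1 / of_nat m) :: rat)"
      using mn by (simp add: field_simps)
    moreover have "\<dots> \<in> H"
      using that by (intro rat_subgroup_add[OF H] rat_subgroup_int_mult[OF H]) (auto simp: S_def)
    ultimately show ?thesis using \<open>lcm m n > 0\<close> by (simp add: S_def)
  qed
  have down: "S m" if mn: "m dvd n" "S n" for m n
  proof -
    obtain k where k: "n = m * k" using mn(1) by (rule dvdE)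
    then have "m > 0" "k > 0" using that by (auto simp: S_def)
    then have "1 / of_nat m = (of_int (int k) * (1 / of_nat n) :: rat)" using k by simp
    then have "1 / of_nat m \<in> H"
      using rat_subgroup_int_mult[OF H, of "1 / of_nat n" "int k"] that by (simp add: S_def)
    then show ?thesis using \<open>m > 0\<close> by (simp add: S_def)
  qed
  obtain z where z: "z \<in> zhat" "\<And>n. n > 0 \<Longrightarrow> z n = 0 \<longleftrightarrow> S n"
    using ex_zhat_divisors_iff[of S] one lcm down by (auto simp: S_def)
  have "q \<in> carrier (Lambda_group ((z, 1), r)) \<longleftrightarrow> q \<in> H" for q r
  proof -
    obtain i j where q: "q = of_int i / of_nat j" "0 < j" "coprime i (int j)"
      by (rule rat_fraction_coprime)
    have "q \<in> carrier (Lambda_group ((z, 1), r)) \<longleftrightarrow> int j dvd i * z j"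
      using Lambda_mem_iff[OF z(1), of 1 j i r] q by simp
    also have "\<dots> \<longleftrightarrow> int j dvd z j"
      using q(3) by (intro coprime_dvd_mult_right_iff) (simp add: coprime_commute)
    also have "\<dots> \<longleftrightarrow> 1 / of_nat j \<in> H"
      using z q(2) zhat_eq_0_iff[OF z(1)] by (simp add: S_def)
    also have "\<dots> \<longleftrightarrow> q \<in> H"
    proof
      assume "1 / of_nat j \<in> H"
      then show "q \<in> H" using rat_subgroup_int_mult[OF H, of "1 / of_nat j" i] q by simp
    next
      assume qH: "q \<in> H"
      obtain u v where uv: "u * i + v * int j = 1"
        using bezout_int[of i "int j"] q(3) by auto
      have "of_int (u * i + v * int j) = (1 :: rat)" by (simp only: uv of_int_1)
      then have "1 / of_nat j = of_int u * q + of_int v * 1"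
        unfolding q(1) using q(2) by (simp add: field_simps)
      also have "\<dots> \<in> H"
        by (intro rat_subgroup_add[OF H] rat_subgroup_int_mult[OF H] qH one)
      finally show "1 / of_nat j \<in> H" .
    qed
    finally show ?thesis .
  qed
  then show ?thesis using z(1) by blast
qed

text \<open>Rank one makes \<open>f x / f x0\<close> rational for a fixed nontrivial
  \<open>x0\<close>. These ratios embed \<open>L\<close> in the rationals with \<open>x0\<close>
  sent to 1, and the image is the lattice of an adele.\<close>

lemma arith_divisor_iso_Lambda:
  assumes D: "arith_divisor (L, N)"
  shows "\<exists>a\<in>adeles. div_iso (Lambda a) (L, N)"
proof -
  have tf: "torsion_free_rank1 L" using D by (simp add: arith_divisor_def)
  then interpret L: comm_group L by (simp add: torsion_free_rank1_def)
  interpret R: comm_group real_add_group by (rule comm_group_real_add)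
  obtain f lam where f: "f \<in> hom L real_add_group" "inj_on f (carrier L)" "0 \<le> lam"
    and N: "\<And>x. x \<in> carrier L \<Longrightarrow> N x = lam * \<bar>f x\<bar>"
    using D by (auto simp: arith_divisor_def)
  interpret f: group_hom L real_add_group f by unfold_locales (rule f(1))
  have f_mult: "f (x \<otimes>\<^bsub>L\<^esub> y) = f x + f y" if "x \<in> carrier L" "y \<in> carrier L" for x y
    using hom_mult[OF f(1) that] by (simp add: real_add_group_def)
  have f_one: "f \<one>\<^bsub>L\<^esub> = 0" using f.hom_one by (simp add: real_add_group_def)
  have f_pow: "f (x [^]\<^bsub>L\<^esub> k) = of_int k * f x" if "x \<in> carrier L" for x and k :: int
    using f.hom_int_pow[OF that, of k] additive_group_int_pow[OF R.group_axioms, of "f x" k]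
    by (simp add: real_add_group_def)
  obtain x0 where x0: "x0 \<in> carrier L" "x0 \<noteq> \<one>\<^bsub>L\<^esub>"
    using tf by (auto simp: torsion_free_rank1_def)
  have fx0: "f x0 \<noteq> 0"
    using inj_onD[OF f(2), of x0 "\<one>\<^bsub>L\<^esub>"] x0 f_one by auto
  have "\<exists>q. f x = real_of_rat q * f x0" if x: "x \<in> carrier L" for x
  proof -
    obtain m n :: int where mn: "m \<noteq> 0 \<or> n \<noteq> 0" "x [^]\<^bsub>L\<^esub> m \<otimes>\<^bsub>L\<^esub> x0 [^]\<^bsub>L\<^esub> n = \<one>\<^bsub>L\<^esub>"
      using tf x x0 unfolding torsion_free_rank1_def by blast
    have "of_int m * f x + of_int n * f x0 = 0"
      using arg_cong[OF mn(2), of f] x x0 by (simp add: f_pow real_add_group_def)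
    moreover from this have "m \<noteq> 0" using mn(1) fx0 by auto
    ultimately have "f x = real_of_rat (- of_int n / of_int m) * f x0"
      by (simp add: of_rat_divide of_rat_minus field_simps)
    then show ?thesis by blast
  qed
  then obtain g where g: "\<And>x. x \<in> carrier L \<Longrightarrow> f x = real_of_rat (g x) * f x0" by metis
  have g_mult: "g (x \<otimes>\<^bsub>L\<^esub> y) = g x + g y" if "x \<in> carrier L" "y \<in> carrier L" for x y
  proof -
    have "real_of_rat (g (x \<otimes>\<^bsub>L\<^esub> y)) * f x0 = real_of_rat (g x + g y) * f x0"
      using f_mult[OF that] g[OF that(1)] g[OF that(2)] g[of "x \<otimes>\<^bsub>L\<^esub> y"] that
      by (simp add: of_rat_add distrib_right)
    then show ?thesis using fx0 by simp
  qed
  have g_one: "g \<one>\<^bsub>L\<^esub> = 0" using g[of "\<one>\<^bsub>L\<^esub>"] f_one fx0 by simp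
  have g_x0: "g x0 = 1" using g[OF x0(1)] fx0 by simp
  have g_inv: "g (inv\<^bsub>L\<^esub> x) = - g x" if "x \<in> carrier L" for x
    using g_mult[of "inv\<^bsub>L\<^esub> x" x] that g_one by (simp add: eq_neg_iff_add_eq_0)
  have sub: "rat_subgroup (g ` carrier L)"
    unfolding rat_subgroup_def
  proof (intro conjI ballI)
    show "0 \<in> g ` carrier L" using g_one by (metis L.one_closed image_eqI)
    fix p q assume "p \<in> g ` carrier L" "q \<in> g ` carrier L"
    then obtain x y where xy: "x \<in> carrier L" "p = g x" "y \<in> carrier L" "q = g y" by blast
    then have "p - q = g (x \<otimes>\<^bsub>L\<^esub> inv\<^bsub>L\<^esub> y)" by (simp add: g_mult g_inv)
    then show "p - q \<in> g ` carrier L" using xy by blast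
  qed
  obtain z where z: "z \<in> zhat" "\<And>r. carrier (Lambda_group ((z, 1), r)) = g ` carrier L"
    using ex_Lambda_carrier[OF sub] g_x0 x0 by (metis image_eqI)
  \<comment> \<open>The factor \<open>\<bar>f x0\<bar>\<close> undoes the normalisation
    \<open>g x0 = 1\<close> in the norm.\<close>
  define a where "a = ((z, 1::nat), lam * \<bar>f x0\<bar>)"
  have a: "a \<in> adeles" using z by (simp add: a_def adeles_def)
  have carr: "carrier (Lambda_group a) = g ` carrier L" unfolding a_def by (rule z(2))
  have "inj_on g (carrier L)"
    by (rule inj_onI) (metis g f(2) inj_onD)
  then have iso: "g \<in> iso L (Lambda_group a)"
    using carr by (auto simp: iso_def bij_betw_def g_mult intro!: homI)
  have "inv_into (carrier L) g \<in> iso (Lambda_group a) L" by (rule L.iso_set_sym[OF iso])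
  moreover have "N (inv_into (carrier L) g q) = \<bar>snd a\<bar> * \<bar>real_of_rat q\<bar>"
    if "q \<in> carrier (Lambda_group a)" for q
  proof -
    let ?x = "inv_into (carrier L) g q"
    have x: "?x \<in> carrier L" "g ?x = q"
      using that carr by (auto intro: inv_into_into f_inv_into_f)
    show ?thesis
      using N[OF x(1)] g[OF x(1)] x(2) f(3) by (simp add: a_def abs_mult)
  qed
  ultimately show ?thesis
    using a by (auto simp: div_iso_def Lambda_def)
qed

section \<open>Tensor products\<close>

lemma tensor_rels_subset:
  assumes "group L1" "group L2"
  shows "tensor_rels L1 L2 \<subseteq> carrier (free_Abelian_group (carrier L1 \<times> carrier L2))"
proof -
  interpret L1: group L1 by fact
  interpret L2: group L2 by fact
  have "Poly_Mapping.keys (frag_of p - frag_of q - frag_of r) \<subseteq> {p, q, r}" for p q r :: "'a \<times> 'b"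
    using keys_diff[of "frag_of p - frag_of q" "frag_of r"] keys_diff[of "frag_of p" "frag_of q"] by auto
  then show ?thesis
    unfolding tensor_rels_def by (fastforce simp: subset_iff)
qed

lemma tensor_rels_subgroup:
  assumes "group L1" "group L2"
  shows "subgroup (generate (free_Abelian_group (carrier L1 \<times> carrier L2)) (tensor_rels L1 L2))
           (free_Abelian_group (carrier L1 \<times> carrier L2))"
  by (intro group.generate_is_subgroup group_free_Abelian_group tensor_rels_subset assms)

lemma tensor_rels_normal:
  assumes "group L1" "group L2"
  shows "generate (free_Abelian_group (carrier L1 \<times> carrier L2)) (tensor_rels L1 L2)
           \<lhd> free_Abelian_group (carrier L1 \<times> carrier L2)"
  using tensor_rels_subgroup[OF assms]
  by (simp add: comm_group.normal_iff_subgroup[OF abelian_free_Abelian_group])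

lemma comm_group_tensor:
  assumes "group L1" "group L2"
  shows "comm_group (tensor_group L1 L2)"
  unfolding tensor_group_def
  by (intro comm_group.abelian_FactGroup abelian_free_Abelian_group tensor_rels_subgroup assms)

lemma tensor_elem_closed:
  assumes "x \<in> carrier L1" "y \<in> carrier L2"
  shows "tensor_elem L1 L2 x y \<in> carrier (tensor_group L1 L2)"
  unfolding tensor_group_def tensor_elem_def carrier_FactGroup
  by (rule imageI) (simp add: assms)

text \<open>Both families in \<open>tensor_rels\<close> have the shape \<open>r - p - q\<close>, so
  one argument in the quotient yields additivity in either variable.\<close>

lemma tensor_coset_add:
  fixes L1 :: "'a monoid" and L2 :: "'b monoid"
  defines "F \<equiv> free_Abelian_group (carrier L1 \<times> carrier L2)"
  defines "R \<equiv> generate F (tensor_rels L1 L2)"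
  assumes L: "group L1" "group L2"
    and p: "p \<in> carrier L1 \<times> carrier L2" and q: "q \<in> carrier L1 \<times> carrier L2"
    and rel: "frag_of r - frag_of p - frag_of q \<in> tensor_rels L1 L2"
  shows "R #>\<^bsub>F\<^esub> frag_of r = (R #>\<^bsub>F\<^esub> frag_of p) \<otimes>\<^bsub>tensor_group L1 L2\<^esub> (R #>\<^bsub>F\<^esub> frag_of q)"
proof -
  interpret F: group F by (simp add: F_def)
  interpret R: normal R F
    unfolding R_def F_def by (rule tensor_rels_normal[OF L])
  have pq: "frag_of p \<in> carrier F" "frag_of q \<in> carrier F" using p q by (auto simp: F_def)
  have pq': "frag_of p + frag_of q \<in> carrier F"
    using F.m_closed[OF pq] by (simp add: F_def)
  have "frag_of r - frag_of p - frag_of q \<in> R"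
    unfolding R_def by (rule generate.incl[OF rel])
  then have "(frag_of r - frag_of p - frag_of q) \<otimes>\<^bsub>F\<^esub> (frag_of p + frag_of q)
      \<in> R #>\<^bsub>F\<^esub> (frag_of p + frag_of q)"
    by (rule F.rcosI[OF _ R.subset pq'])
  moreover have "(frag_of r - frag_of p - frag_of q) \<otimes>\<^bsub>F\<^esub> (frag_of p + frag_of q) = frag_of r"
    by (simp add: F_def)
  ultimately have "R #>\<^bsub>F\<^esub> frag_of r = R #>\<^bsub>F\<^esub> (frag_of p + frag_of q)"
    using F.repr_independence[OF _ pq' R.subgroup_axioms] by simp
  also have "\<dots> = (R #>\<^bsub>F\<^esub> frag_of p) <#>\<^bsub>F\<^esub> (R #>\<^bsub>F\<^esub> frag_of q)"
    using R.rcos_sum[OF pq] by (simp add: F_def)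
  finally show ?thesis by (simp add: tensor_group_def F_def R_def)
qed

lemma tensor_elem_mult_left:
  assumes L: "group L1" "group L2"
    and x: "x \<in> carrier L1" "x' \<in> carrier L1" "y \<in> carrier L2"
  shows "tensor_elem L1 L2 (x \<otimes>\<^bsub>L1\<^esub> x') y =
     tensor_elem L1 L2 x y \<otimes>\<^bsub>tensor_group L1 L2\<^esub> tensor_elem L1 L2 x' y"
  unfolding tensor_elem_def
  by (rule tensor_coset_add[OF L]) (use x in \<open>auto simp: tensor_rels_def\<close>)

lemma tensor_elem_mult_right:
  assumes L: "group L1" "group L2"
    and x: "x \<in> carrier L1" "y \<in> carrier L2" "y' \<in> carrier L2"
  shows "tensor_elem L1 L2 x (y \<otimes>\<^bsub>L2\<^esub> y') =
     tensor_elem L1 L2 x y \<otimes>\<^bsub>tensor_group L1 L2\<^esub> tensor_elem L1 L2 x y'"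
  unfolding tensor_elem_def
  by (rule tensor_coset_add[OF L]) (use x in \<open>auto simp: tensor_rels_def\<close>)

text \<open>Both sides are the \<open>k\<close>-th power of the tensor of \<open>x\<close> and
  \<open>y\<close>, by additivity in each variable. Integers thus move across the tensor
  sign.\<close>

lemma tensor_elem_int_pow:
  assumes L: "group L1" "group L2" and x: "x \<in> carrier L1" and y: "y \<in> carrier L2"
  shows "tensor_elem L1 L2 (x [^]\<^bsub>L1\<^esub> (k::int)) y = tensor_elem L1 L2 x (y [^]\<^bsub>L2\<^esub> k)"
proof -
  have T: "group (tensor_group L1 L2)"
    using comm_group_tensor[OF L] by (simp add: comm_group_def)
  have "(\<lambda>x. tensor_elem L1 L2 x y) \<in> hom L1 (tensor_group L1 L2)"
    by (rule homI) (use y in \<open>auto simp: tensor_elem_closed tensor_elem_mult_left[OF L]\<close>)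
  from hom_int_pow[OF this x L(1) T] 
  have "tensor_elem L1 L2 (x [^]\<^bsub>L1\<^esub> k) y = tensor_elem L1 L2 x y [^]\<^bsub>tensor_group L1 L2\<^esub> k" .
  moreover have "(\<lambda>y. tensor_elem L1 L2 x y) \<in> hom L2 (tensor_group L1 L2)"
    by (rule homI) (use x in \<open>auto simp: tensor_elem_closed tensor_elem_mult_right[OF L]\<close>)
  from hom_int_pow[OF this y L(2) T] 
  have "tensor_elem L1 L2 x (y [^]\<^bsub>L2\<^esub> k) = tensor_elem L1 L2 x y [^]\<^bsub>tensor_group L1 L2\<^esub> k" .
  ultimately show ?thesis by simp
qed

text \<open>The universal property: \<beta> extends to the free abelian group, bilinearity puts the
  relations in the kernel, and the extension factors through the quotient.\<close>

lemma tensor_lift: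
  assumes L: "group L1" "group L2" and G: "comm_group G"
    and closed: "\<And>x y. x \<in> carrier L1 \<Longrightarrow> y \<in> carrier L2 \<Longrightarrow> \<beta> x y \<in> carrier G"
    and left: "\<And>x x' y. \<lbrakk>x \<in> carrier L1; x' \<in> carrier L1; y \<in> carrier L2\<rbrakk>
                 \<Longrightarrow> \<beta> (x \<otimes>\<^bsub>L1\<^esub> x') y = \<beta> x y \<otimes>\<^bsub>G\<^esub> \<beta> x' y"
    and right: "\<And>x y y'. \<lbrakk>x \<in> carrier L1; y \<in> carrier L2; y' \<in> carrier L2\<rbrakk>
                 \<Longrightarrow> \<beta> x (y \<otimes>\<^bsub>L2\<^esub> y') = \<beta> x y \<otimes>\<^bsub>G\<^esub> \<beta> x y'"
  obtains h where "h \<in> hom (tensor_group L1 L2) G"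
    "\<And>x y. x \<in> carrier L1 \<Longrightarrow> y \<in> carrier L2 \<Longrightarrow> h (tensor_elem L1 L2 x y) = \<beta> x y"
proof -
  define F where "F = free_Abelian_group (carrier L1 \<times> carrier L2)"
  define R where "R = generate F (tensor_rels L1 L2)"
  interpret L1: group L1 by fact
  interpret L2: group L2 by fact
  interpret G: comm_group G by fact
  have "(\<lambda>(x, y). \<beta> x y) ` (carrier L1 \<times> carrier L2) \<subseteq> carrier G"
    using closed by auto
  from G.free_Abelian_group_universal[OF this]
  obtain k where k: "k \<in> hom F G" and
    k_of: "\<And>p. p \<in> carrier L1 \<times> carrier L2 \<Longrightarrow> k (frag_of p) = (\<lambda>(x, y). \<beta> x y) p"
    unfolding F_def by metis
  interpret k: group_hom F G k
    unfolding group_hom_def group_hom_axioms_def using k by (simp add: F_def G.is_group)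
  have k_rel: "frag_of r - frag_of p - frag_of q \<in> kernel F G k"
    if p: "p \<in> carrier L1 \<times> carrier L2" and q: "q \<in> carrier L1 \<times> carrier L2"
      and r: "r \<in> carrier L1 \<times> carrier L2"
      and add: "k (frag_of r) = k (frag_of p) \<otimes>\<^bsub>G\<^esub> k (frag_of q)" for p q r
  proof -
    have car: "frag_of p \<in> carrier F" "frag_of q \<in> carrier F" "frag_of r \<in> carrier F"
      using p q r by (auto simp: F_def)
    \<comment> \<open>The difference is rewritten with the group operations of \<open>F\<close>, so
      that the homomorphism laws of \<open>k\<close> apply.\<close>
    have inv: "inv\<^bsub>F\<^esub> (frag_of p \<otimes>\<^bsub>F\<^esub> frag_of q) = - (frag_of p + frag_of q)"
      using k.G.m_closed[OF car(1,2)] by (simp add: F_def)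
    have eq: "frag_of r - frag_of p - frag_of q = frag_of r \<otimes>\<^bsub>F\<^esub> inv\<^bsub>F\<^esub> (frag_of p \<otimes>\<^bsub>F\<^esub> frag_of q)"
      unfolding inv by (simp add: F_def)
    have "k (frag_of r \<otimes>\<^bsub>F\<^esub> inv\<^bsub>F\<^esub> (frag_of p \<otimes>\<^bsub>F\<^esub> frag_of q))
        = k (frag_of r) \<otimes>\<^bsub>G\<^esub> inv\<^bsub>G\<^esub> (k (frag_of p) \<otimes>\<^bsub>G\<^esub> k (frag_of q))"
      using car by simp
    also have "\<dots> = \<one>\<^bsub>G\<^esub>" using add car by simp
    finally show ?thesis unfolding eq kernel_def using car by simp
  qed
  have "tensor_rels L1 L2 \<subseteq> kernel F G k"
    unfolding tensor_rels_def by (auto intro!: k_rel simp: k_of left right)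
  then have "R \<subseteq> kernel F G k"
    unfolding R_def by (rule k.G.generate_subgroup_incl[OF _ k.subgroup_kernel])
  moreover have "R \<lhd> F" unfolding R_def F_def by (rule tensor_rels_normal[OF L])
  ultimately obtain h where h: "h \<in> hom (F Mod R) G"
    "\<And>c. c \<in> carrier F \<Longrightarrow> h (R #>\<^bsub>F\<^esub> c) = k c"
    using k.FactGroup_universal_kernel by metis
  show thesis
  proof (rule that)
    show "h \<in> hom (tensor_group L1 L2) G" using h(1) by (simp add: tensor_group_def F_def R_def)
    fix x y assume "x \<in> carrier L1" "y \<in> carrier L2"
    then show "h (tensor_elem L1 L2 x y) = \<beta> x y"
      using h(2)[of "frag_of (x, y)"] k_of[of "(x, y)"] by (simp add: tensor_elem_def F_def R_def)
  qed
qed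

text \<open>Pulls induction on the free abelian group, with its closure under differences, through
  the quotient map \<pi>.\<close>

lemma tensor_induct:
  assumes L: "group L1" "group L2" and t: "t \<in> carrier (tensor_group L1 L2)"
    and one: "P \<one>\<^bsub>tensor_group L1 L2\<^esub>"
    and elem: "\<And>x y. x \<in> carrier L1 \<Longrightarrow> y \<in> carrier L2 \<Longrightarrow> P (tensor_elem L1 L2 x y)"
    and diff: "\<And>s t. \<lbrakk>s \<in> carrier (tensor_group L1 L2); t \<in> carrier (tensor_group L1 L2); P s; P t\<rbrakk>
                 \<Longrightarrow> P (s \<otimes>\<^bsub>tensor_group L1 L2\<^esub> inv\<^bsub>tensor_group L1 L2\<^esub> t)"
  shows "P t"
proof -
  define F where "F = free_Abelian_group (carrier L1 \<times> carrier L2)"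
  define R where "R = generate F (tensor_rels L1 L2)"
  define \<pi> where "\<pi> c = R #>\<^bsub>F\<^esub> c" for c
  interpret F: group F by (simp add: F_def)
  interpret R: normal R F unfolding R_def F_def by (rule tensor_rels_normal[OF L])
  have T: "tensor_group L1 L2 = F Mod R" by (simp add: tensor_group_def F_def R_def)
  interpret T: group "F Mod R" by (rule R.factorgroup_is_group)
  have hom: "\<pi> \<in> hom F (F Mod R)" unfolding \<pi>_def by (rule R.r_coset_hom_Mod)
  interpret \<pi>: group_hom F "F Mod R" \<pi> by unfold_locales (rule hom)
  obtain c where c: "c \<in> carrier F" "t = \<pi> c"
    using t by (auto simp: T carrier_FactGroup \<pi>_def)
  have "Poly_Mapping.keys c \<subseteq> carrier L1 \<times> carrier L2" using c(1) by (simp add: F_def)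
  then have "P (\<pi> c)"
  proof (rule free_Abelian_group_induct[where P = "\<lambda>c. P (\<pi> c)"])
    show "P (\<pi> 0)" using one \<pi>.hom_one by (simp add: T F_def)
  next
    fix x y :: "('a \<times> 'b) \<Rightarrow>\<^sub>0 int"
    assume xy: "Poly_Mapping.keys x \<subseteq> carrier L1 \<times> carrier L2"
      "Poly_Mapping.keys y \<subseteq> carrier L1 \<times> carrier L2" and P: "P (\<pi> x)" "P (\<pi> y)"
    have car: "x \<in> carrier F" "y \<in> carrier F" using xy by (simp_all add: F_def)
    have "x - y = x \<otimes>\<^bsub>F\<^esub> inv\<^bsub>F\<^esub> y" using xy by (simp add: F_def)
    then have "\<pi> (x - y) = \<pi> x \<otimes>\<^bsub>F Mod R\<^esub> inv\<^bsub>F Mod R\<^esub> \<pi> y"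
      using car by (simp del: mult_FactGroup)
    then show "P (\<pi> (x - y))"
      using diff[unfolded T, OF \<pi>.hom_closed[OF car(1)] \<pi>.hom_closed[OF car(2)] P] by simp
  next
    fix p :: "'a \<times> 'b" assume "p \<in> carrier L1 \<times> carrier L2"
    then show "P (\<pi> (frag_of p))"
      using elem[of "fst p" "snd p"] by (auto simp: tensor_elem_def \<pi>_def F_def R_def)
  qed
  then show ?thesis using c by simp
qed

section \<open>Tensor products of adele lattices\<close>

text \<open>A difference of two pure tensors is pure: if \<open>x = i g\<close> and
  \<open>x' = j g\<close>, both can be written with first factor \<open>g\<close>, and additivity in
  the second variable combines them.\<close>

lemma tensor_Lambda_pure:
  assumes a: "a \<in> adeles" and b: "b \<in> adeles"
    and t: "t \<in> carrier (tensor_group (Lambda_group a) (Lambda_group b))"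
  shows "\<exists>x\<in>carrier (Lambda_group a). \<exists>y\<in>carrier (Lambda_group b).
           t = tensor_elem (Lambda_group a) (Lambda_group b) x y"
proof -
  let ?A = "Lambda_group a" and ?B = "Lambda_group b"
  let ?T = "tensor_group ?A ?B" and ?e = "tensor_elem ?A ?B"
  have L: "group ?A" "group ?B"
    using comm_group_Lambda[OF a] comm_group_Lambda[OF b] by (simp_all add: comm_group_def)
  interpret A: group ?A by fact
  interpret B: group ?B by fact
  interpret T: comm_group ?T by (rule comm_group_tensor[OF L])
  show ?thesis
  proof (rule tensor_induct[OF L t])
    \<comment> \<open>The tensor of the two identities is idempotent, hence the identity.\<close>
    have "?e \<one>\<^bsub>?A\<^esub> \<one>\<^bsub>?B\<^esub> \<otimes>\<^bsub>?T\<^esub> ?e \<one>\<^bsub>?A\<^esub> \<one>\<^bsub>?B\<^esub> = ?e \<one>\<^bsub>?A\<^esub> \<one>\<^bsub>?B\<^esub>"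
      using tensor_elem_mult_left[OF L A.one_closed A.one_closed B.one_closed] A.r_one[OF A.one_closed]
      by metis
    then have "?e \<one>\<^bsub>?A\<^esub> \<one>\<^bsub>?B\<^esub> = \<one>\<^bsub>?T\<^esub>"
      using tensor_elem_closed[OF A.one_closed B.one_closed] by (simp add: T.l_cancel_one)
    then show "\<exists>x\<in>carrier ?A. \<exists>y\<in>carrier ?B. \<one>\<^bsub>?T\<^esub> = ?e x y"
      using A.one_closed B.one_closed by metis
  next
    fix s t assume "\<exists>x\<in>carrier ?A. \<exists>y\<in>carrier ?B. s = ?e x y" "\<exists>x\<in>carrier ?A. \<exists>y\<in>carrier ?B. t = ?e x y"
    then obtain x y x' y' where xy: "x \<in> carrier ?A" "y \<in> carrier ?B" "s = ?e x y"
      "x' \<in> carrier ?A" "y' \<in> carrier ?B" "t = ?e x' y'" by blast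
    obtain g i j where g: "g \<in> carrier ?A" "x = of_int i * g" "x' = of_int j * g"
      by (rule rat_subgroup_common_generator[OF Lambda_rat_subgroup[OF a] xy(1,4)])
    have s: "s = ?e g (y [^]\<^bsub>?B\<^esub> i)"
      using tensor_elem_int_pow[OF L g(1) xy(2), of i] Lambda_int_pow[OF a g(1)] xy g by simp
    have t: "t = ?e g (y' [^]\<^bsub>?B\<^esub> j)"
      using tensor_elem_int_pow[OF L g(1) xy(5), of j] Lambda_int_pow[OF a g(1)] xy g by simp
    have "(\<lambda>y. ?e g y) \<in> hom ?B ?T"
      by (rule homI) (use g(1) tensor_elem_mult_right[OF L g(1)] in \<open>auto simp: tensor_elem_closed\<close>)
    then interpret h: group_hom ?B ?T "\<lambda>y. ?e g y" by unfold_locales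
    have "s \<otimes>\<^bsub>?T\<^esub> inv\<^bsub>?T\<^esub> t = ?e g (y [^]\<^bsub>?B\<^esub> i \<otimes>\<^bsub>?B\<^esub> inv\<^bsub>?B\<^esub> (y' [^]\<^bsub>?B\<^esub> j))"
      unfolding s t using xy(2,5) h.hom_mult h.hom_inv by (metis B.int_pow_closed B.inv_closed)
    moreover have "y [^]\<^bsub>?B\<^esub> i \<otimes>\<^bsub>?B\<^esub> inv\<^bsub>?B\<^esub> (y' [^]\<^bsub>?B\<^esub> j) \<in> carrier ?B"
      by (intro B.m_closed B.inv_closed B.int_pow_closed xy)
    ultimately show "\<exists>x\<in>carrier ?A. \<exists>y\<in>carrier ?B. s \<otimes>\<^bsub>?T\<^esub> inv\<^bsub>?T\<^esub> t = ?e x y"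
      using g(1) by blast
  qed blast
qed

lemma adele_mult_closed: "a \<in> adeles \<Longrightarrow> b \<in> adeles \<Longrightarrow> adele_mult a b \<in> adeles"
  by (auto simp: adeles_def adele_mult_def afin_mult_def zmul_closed)

text \<open>The two divisibilities are lifted to the common level \<open>M\<close> and multiplied;
  the product of their moduli is exactly \<open>M\<close>.\<close>

lemma Lambda_mult_mem:
  assumes a: "a \<in> adeles" and b: "b \<in> adeles"
    and x: "x \<in> carrier (Lambda_group a)" and y: "y \<in> carrier (Lambda_group b)"
  shows "x * y \<in> carrier (Lambda_group (adele_mult a b))"
proof -
  obtain z d r where za: "a = ((z, d), r)" "z \<in> zhat" "d > 0" using a by (auto simp: adeles_def)
  obtain w e s where wb: "b = ((w, e), s)" "w \<in> zhat" "e > 0" using b by (auto simp: adeles_def)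
  obtain i j where ij: "x = of_int i / of_nat j" "0 < j" by (rule rat_fraction)
  obtain k l where kl: "y = of_int k / of_nat l" "0 < l" by (rule rat_fraction)
  define M where "M = (j * l) * (d * e)"
  have M: "M > 0" using ij kl za wb by (simp add: M_def)
  have "int (j * d) dvd i * z (j * d)"
    using x Lambda_mem_iff[OF za(2,3) ij(2)] unfolding ij(1) za(1) by blast
  moreover have "[i * z (j * d) = i * z M] (mod int (j * d))"
    by (intro cong_scalar_left zhat_cong[OF za(2) M]) (simp add: M_def)
  ultimately have 1: "int (j * d) dvd i * z M" by (simp only: cong_dvd_iff)
  have "int (l * e) dvd k * w (l * e)"
    using y Lambda_mem_iff[OF wb(2,3) kl(2)] unfolding kl(1) wb(1) by blast
  moreover have "[k * w (l * e) = k * w M] (mod int (l * e))"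
    by (intro cong_scalar_left zhat_cong[OF wb(2) M]) (simp add: M_def)
  ultimately have 2: "int (l * e) dvd k * w M" by (simp only: cong_dvd_iff)
  have "int (j * d) * int (l * e) dvd (i * z M) * (k * w M)"
    by (rule mult_dvd_mono[OF 1 2])
  moreover have "int (j * d) * int (l * e) = int M" by (simp add: M_def)
  moreover have "(i * z M) * (k * w M) = (i * k) * (z M * w M)" by simp
  ultimately have "int M dvd (i * k) * (z M * w M)" by metis
  then have "int M dvd (i * k) * zmul z w M"
    using cong_dvd_iff[OF cong_scalar_left[OF zmul_cong[OF M, of z w], of "i * k"]] by simp
  then have "of_int (i * k) / of_nat (j * l) \<in> carrier (Lambda_group ((zmul z w, d * e), r * s))"
    using Lambda_mem_iff[OF zmul_closed[OF za(2) wb(2)], of "d * e" "j * l" "i * k" "r * s"] za wb ij kl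
    by (simp add: M_def)
  moreover have "of_int (i * k) / of_nat (j * l) = x * y" by (simp add: ij(1) kl(1))
  ultimately show ?thesis by (simp add: za(1) wb(1) adele_mult_def afin_mult_def)
qed

text \<open>If \<open>k\<close> divides \<open>z w\<close>, then \<open>k\<close> splits as
  \<open>k1 = gcd (z k) k\<close>, which divides \<open>z\<close>, times \<open>k2\<close>, which
  divides \<open>w\<close>. Accordingly \<open>q\<close> is the product of \<open>d m / k1\<close>
  and \<open>e / k2\<close>.\<close>

lemma Lambda_mult_factor:
  assumes a: "a \<in> adeles" and b: "b \<in> adeles"
    and q: "q \<in> carrier (Lambda_group (adele_mult a b))"
  obtains x y where "x \<in> carrier (Lambda_group a)" "y \<in> carrier (Lambda_group b)" "q = x * y"
proof -
  obtain z d r where za: "a = ((z, d), r)" "z \<in> zhat" "d > 0" using a by (auto simp: adeles_def)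
  obtain w e s where wb: "b = ((w, e), s)" "w \<in> zhat" "e > 0" using b by (auto simp: adeles_def)
  note zw = zmul_closed[OF za(2) wb(2)]
  \<comment> \<open>Reducing \<open>q / (d e)\<close> rather than \<open>q\<close> absorbs the
    adelic denominators: integrality becomes divisibility of \<open>z w\<close> by
    \<open>k\<close>.\<close>
  obtain m k where mk: "q / of_nat (d * e) = of_int m / of_nat k" "0 < k" "coprime m (int k)"
    by (rule rat_fraction_coprime)
  have qmk: "q = of_int (int (d * e) * m) / of_nat k"
    using mk(1,2) za(3) wb(3) by (simp add: field_simps)
  have "int (k * (d * e)) dvd (int (d * e) * m) * zmul z w (k * (d * e))"
    using q Lambda_mem_iff[OF zw _ mk(2), of "d * e" "int (d * e) * m" "r * s"] za wb
    unfolding qmk by (simp add: adele_mult_def afin_mult_def)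
  then have "int ((d * e) * k) dvd (int (d * e) * m) * zmul z w ((d * e) * k)"
    by (simp add: mult.commute)
  then have "int k dvd m * zmul z w k"
    using zhat_dvd_cancel[OF zw _ mk(2), of "d * e" m] za wb by simp
  then have "int k dvd zmul z w k"
    using mk(3) by (simp add: coprime_dvd_mult_right_iff coprime_commute)
  then have kzw: "int k dvd z k * w k"
    using cong_dvd_iff[OF zmul_cong[OF mk(2), of z w]] by simp
  define k1 where "k1 = nat (gcd (z k) (int k))"
  have k1: "int k1 = gcd (z k) (int k)" "k1 > 0" using mk(2) by (simp_all add: k1_def)
  obtain z' k2' where z': "z k = int k1 * z'" "int k = int k1 * k2'" "coprime z' k2'"
    using gcd_coprime_exists[of "z k" "int k"] mk(2) k1 by (metis gcd_eq_0_iff mult.commute of_nat_0_less_iff less_irrefl)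
  define k2 where "k2 = nat k2'"
  have "k2' > 0" using z'(2) k1(2) mk(2) by (metis of_nat_0_less_iff zero_less_mult_pos)
  then have k2: "int k2 = k2'" "k2 > 0" by (simp_all add: k2_def)
  have kk: "k = k1 * k2" using z'(2) k2(1) by (metis of_nat_eq_iff of_nat_mult)
  have "int k1 * int k2 dvd int k1 * (z' * w k)" using kzw z' k2 by (simp add: mult.assoc)
  then have "int k2 dvd z' * w k" using k1(2) by simp
  then have "int k2 dvd w k"
    using z'(3) k2 by (simp add: coprime_dvd_mult_right_iff coprime_commute)
  then have "int k2 dvd w k2"
    using zhat_mod[OF wb(2) mk(2), of k2] kk by (simp add: dvd_eq_mod_eq_0)
  then have "int (e * k2) dvd (int e * 1) * w (e * k2)"
    using zhat_dvd_cancel[OF wb(2,3) k2(2), of 1] by simp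
  then have y: "of_int (int e) / of_nat k2 \<in> carrier (Lambda_group b)"
    unfolding wb(1) using Lambda_mem_iff[OF wb(2,3) k2(2), of "int e"] by (simp add: mult.commute)
  have "int k1 dvd z k1"
    using zhat_mod[OF za(2) mk(2), of k1] kk z'(1) by (simp add: dvd_eq_mod_eq_0)
  then have "int (d * k1) dvd (int d * m) * z (d * k1)"
    using zhat_dvd_cancel[OF za(2,3) k1(2), of m] by simp
  then have x: "of_int (int d * m) / of_nat k1 \<in> carrier (Lambda_group a)"
    unfolding za(1) using Lambda_mem_iff[OF za(2,3) k1(2), of "int d * m"] by (simp add: mult.commute)
  have "q = of_int (int d * m) / of_nat k1 * (of_int (int e) / of_nat k2)"
    by (simp add: qmk kk)
  then show thesis using that x y by blast
qed

text \<open>Multiplication of rationals induces an isomorphism \<mu> from the tensor product onto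
  the lattice of the product adele. Since \<open>div_prod\<close> chooses its norm, that norm must
  be shown both to exist and to be the expected one.\<close>

lemma div_iso_Lambda_mult:
  assumes a: "a \<in> adeles" and b: "b \<in> adeles"
  shows "div_iso (Lambda (adele_mult a b)) (div_prod (Lambda a) (Lambda b))"
proof -
  let ?A = "Lambda_group a" and ?B = "Lambda_group b" and ?C = "Lambda_group (adele_mult a b)"
  let ?T = "tensor_group ?A ?B" and ?e = "tensor_elem ?A ?B"
  note ab = adele_mult_closed[OF a b]
  have L: "group ?A" "group ?B" and C: "comm_group ?C"
    using comm_group_Lambda[OF a] comm_group_Lambda[OF b] comm_group_Lambda[OF ab]
    by (simp_all add: comm_group_def)
  interpret A: group ?A by fact
  interpret B: group ?B by fact
  interpret C: comm_group ?C by fact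
  interpret T: comm_group ?T by (rule comm_group_tensor[OF L])
  obtain \<mu> where \<mu>: "\<mu> \<in> hom ?T ?C"
    "\<And>x y. x \<in> carrier ?A \<Longrightarrow> y \<in> carrier ?B \<Longrightarrow> \<mu> (?e x y) = x * y"
  proof (rule tensor_lift[OF L C, of "(*)"])
    show "x * y \<in> carrier ?C" if "x \<in> carrier ?A" "y \<in> carrier ?B" for x y
      by (rule Lambda_mult_mem[OF a b that])
  qed (simp_all add: algebra_simps)
  note pure = tensor_Lambda_pure[OF a b]
  interpret \<mu>: group_hom ?T ?C \<mu> by unfold_locales (rule \<mu>(1))
  have e0: "?e x 0 = \<one>\<^bsub>?T\<^esub>" if x: "x \<in> carrier ?A" for x
  proof -
    have "(\<lambda>y. ?e x y) \<in> hom ?B ?T"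
      by (rule homI) (use x tensor_elem_mult_right[OF L x] in \<open>auto simp: tensor_elem_closed\<close>)
    from hom_one[OF this B.is_group T.is_group] show ?thesis by simp
  qed
  have e0': "?e 0 y = \<one>\<^bsub>?T\<^esub>" if y: "y \<in> carrier ?B" for y
  proof -
    have "(\<lambda>x. ?e x y) \<in> hom ?A ?T"
      by (rule homI) (use y tensor_elem_mult_left[OF L _ _ y] in \<open>auto simp: tensor_elem_closed\<close>)
    from hom_one[OF this A.is_group T.is_group] show ?thesis by simp
  qed
  \<comment> \<open>By purity an element of the kernel is a tensor of \<open>x\<close> and
    \<open>y\<close> with \<open>x * y = 0\<close>, so one factor vanishes and the tensor is
    trivial.\<close>
  have ker: "t = \<one>\<^bsub>?T\<^esub>" if "t \<in> carrier ?T" "\<mu> t = 0" for t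
    using pure[OF that(1)] that(2) \<mu>(2) e0 e0' by (metis mult_eq_0_iff)
  have inj: "inj_on \<mu> (carrier ?T)"
    using \<mu>.inj_on_one_iff ker by simp
  have surj: "\<mu> ` carrier ?T = carrier ?C"
  proof
    show "\<mu> ` carrier ?T \<subseteq> carrier ?C" by (auto simp: \<mu>.hom_closed)
    show "carrier ?C \<subseteq> \<mu> ` carrier ?T"
    proof
      fix q assume "q \<in> carrier ?C"
      then obtain x y where xy: "x \<in> carrier ?A" "y \<in> carrier ?B" "q = x * y"
        by (rule Lambda_mult_factor[OF a b])
      then show "q \<in> \<mu> ` carrier ?T"
        using \<mu>(2)[OF xy(1,2)] tensor_elem_closed[OF xy(1,2)] by (metis image_eqI)
    qed
  qed
  have iso: "\<mu> \<in> iso ?T ?C" using \<mu>(1) inj surj by (simp add: iso_def bij_betw_def)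
  define \<phi> where "\<phi> = inv_into (carrier ?T) \<mu>"
  have \<phi>: "\<phi> \<in> iso ?C ?T" unfolding \<phi>_def by (rule T.iso_set_sym[OF iso])
  have \<mu>\<phi>: "\<mu> (\<phi> q) = q" if "q \<in> carrier ?C" for q
    unfolding \<phi>_def by (rule f_inv_into_f) (use that surj in simp)
  have snd_ab: "snd (adele_mult a b) = snd a * snd b" by (simp add: adele_mult_def)
  let ?spec = "\<lambda>N. arith_divisor (?T, N) \<and>
        (\<forall>x \<in> carrier ?A. \<forall>y \<in> carrier ?B. N (?e x y) = snd (Lambda a) x * snd (Lambda b) y)"
  \<comment> \<open>The witness for the choice: the norm of the product adele pulled back along
    \<mu>.\<close>
  define N0 where "N0 t = \<bar>snd a * snd b\<bar> * \<bar>real_of_rat (\<mu> t)\<bar>" for t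
  have "arith_divisor (?C, \<lambda>q. \<bar>snd a * snd b\<bar> * \<bar>real_of_rat q\<bar>)"
    using arith_divisor_Lambda[OF ab] by (simp add: Lambda_def snd_ab)
  then have "arith_divisor (?T, N0)"
    by (rule arith_divisor_iso[OF _ \<phi> T.is_group]) (simp add: N0_def \<mu>\<phi>)
  then have "?spec N0"
    by (simp add: N0_def \<mu>(2) Lambda_def abs_mult of_rat_mult)
  then have spec: "?spec (SOME N. ?spec N)" by (rule someI[of ?spec])
  define N where "N = (SOME N. ?spec N)"
  \<comment> \<open>The chosen norm is prescribed only on pure tensors; purity extends the formula
    to the whole carrier.\<close>
  have N: "N t = \<bar>snd a * snd b\<bar> * \<bar>real_of_rat (\<mu> t)\<bar>" if "t \<in> carrier ?T" for t
  proof -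
    obtain x y where xy: "x \<in> carrier ?A" "y \<in> carrier ?B" "t = ?e x y" using pure[OF \<open>t \<in> carrier ?T\<close>] by blast
    have "N t = snd (Lambda a) x * snd (Lambda b) y"
      using spec xy unfolding N_def by blast
    then show ?thesis using \<mu>(2)[OF xy(1,2)] xy(3) by (simp add: Lambda_def abs_mult of_rat_mult)
  qed
  have "div_prod (Lambda a) (Lambda b) = (?T, N)"
    by (simp add: div_prod_def N_def Lambda_def)
  moreover have "N (\<phi> q) = \<bar>snd (adele_mult a b)\<bar> * \<bar>real_of_rat q\<bar>" if "q \<in> carrier ?C" for q
  proof -
    have "\<phi> q \<in> carrier ?T" using \<phi> that by (auto simp: iso_def hom_def)
    then show ?thesis using N \<mu>\<phi>[OF that] snd_ab by simp
  qed
  ultimately show ?thesis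
    using \<phi> by (auto simp: div_iso_def Lambda_def)
qed

text \<open>On isomorphism classes the equivalence gives well-definedness and injectivity at once,
  the tensor clause gives multiplicativity, and the last clause surjectivity.\<close>

theorem theorem3p4:
  fixes L :: "'a monoid" and N :: "'a \<Rightarrow> real"
  shows "(\<forall>a \<in> adeles. arith_divisor (Lambda a))
       \<and> (\<forall>a \<in> adeles. \<forall>b \<in> adeles. XQ_rel a b \<longleftrightarrow> div_iso (Lambda a) (Lambda b))
       \<and> (\<forall>a \<in> adeles. \<forall>b \<in> adeles.
             div_iso (Lambda (adele_mult a b)) (div_prod (Lambda a) (Lambda b)))
       \<and> (arith_divisor (L, N) \<longrightarrow> (\<exists>a \<in> adeles. div_iso (Lambda a) (L, N)))"
  using arith_divisor_Lambda XQ_rel_iff_div_iso div_iso_Lambda_mult arith_divisor_iso_Lambda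
  by blast

end
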